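(* Let $\mathcal{T}$ be a random dynamical system on $X$ over $(\Omega,\mathcal{B}(\Omega),\mathbb{P},\vartheta)$ with a stationary measure $\mu$. If the random dynamical system has a super-polynomial decay of correlations, then \[\underline{\mathbf{R}}(x)=\underline{d}_\mu(x)\qquad\text{and}\qquad\overline{\mathbf{R}}(x)=\overline{d}_\mu(x)\] for $\mu$-almost every $x\in X$ such that $\underline{d}_\mu(x)>0$.
   Context: Random dynamical system: $\Omega$ is a metric space with Borel $\sigma$-algebra $\mathcal{B}(\Omega)$, $\mathbb{P}$ is a probability measure on $(\Omega,\mathcal{B}(\Omega))$, and $\vartheta:\Omega\to\Omega$ is a measurable $\mathbb{P}$-preserving map. $X$ is a compact Riemannian manifold with distance $d$, and $B(x,r)$ denotes the open ball. A family of maps $T_\omega:X\to X$, $\omega\in\Omega$, is given such that $(\omega,x)\mapsto T_\omega x$ is measurable. For $n\ge 1$ set $T^n_\omega:=T_{\vartheta^{n-1}\omega}\circ\cdots\circ T_{\vartheta\omega}\circ T_\omega$ (and $T^0_\omega=\mathrm{id}$), so that $T^{n+m}_\omega=T^n_{\vartheta^m\omega}\circ T^m_\omega$. These data form the random dynamical system $\mathcal{T}$ on $X$ over $(\Omega,\mathcal{B}(\Omega),\mathbb{P},\vartheta)$. Stationary measure: the skew product is $S:\Omega\times X\to\Omega\times X$, $S(\omega,x)=(\vartheta\omega,T_\omega x)$. A Borel probability measure $\mu$ on $X$ is stationary if $\mathbb{P}\otimes\mu$ is $S$-invariant. Non-instantaneous annealed return times and recurrence rates: for $r>0$, $p\in\mathbb{N}=\{0,1,2,\dots\}$,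 \[\tau^{\omega}_{r,p}(x):=\inf\{k>p: d(T^k_\omega x,x)<r\},\qquad \mathbf{T}_{r,p}(x):=\int_\Omega\tau^{\omega}_{r,p}(x)\,d\mathbb{P}(\omega)\] (with $\inf\emptyset=+\infty$, $\log(+\infty)=+\infty$), and \[\underline{\mathbf{R}}(x):=\lim_{p\to\infty}\liminf_{r\to0}\frac{\log\mathbf{T}_{r,p}(x)}{-\log r},\qquad \overline{\mathbf{R}}(x):=\lim_{p\to\infty}\limsup_{r\to0}\frac{\log\mathbf{T}_{r,p}(x)}{-\log r}.\] Local dimensions: $\underline{d}_\mu(x)=\liminf_{r\to0}\frac{\log\mu(B(x,r))}{\log r}$ and $\overline{d}_\mu(x)=\limsup_{r\to0}\frac{\log\mu(B(x,r))}{\log r}$. Super-polynomial decay of correlations: there is a sequence $(\theta_n)_{n\ge1}$ with $\lim_{n\to\infty}\theta_n n^p=0$ for every $p>0$ such that for all $n\ge1$ and all Lipschitz functions $\psi,\varphi:X\to\mathbb{R}$ \[\left|\int_X\int_\Omega \psi(T^n_\omega x)\varphi(x)\,d\mathbb{P}(\omega)\,d\mu(x)-\int_X\psi\,d\mu\int_X\varphi\,d\mu\right|\le\|\psi\|\,\|\varphi\|\,\theta_n,\] where $\|\cdot\|$ is the Lipschitz norm. *)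

theory Defs
  imports "HOL-Probability.Probability"
begin

text \<open>\<open>C_k_on k f S\<close>: \<open>f\<close> is of class $C^k$ on \<open>S\<close>; only meaningful for open \<open>S\<close>.\<close>

fun C_k_on :: "nat \<Rightarrow> ('a::euclidean_space \<Rightarrow> 'b::real_normed_vector) \<Rightarrow> 'a set \<Rightarrow> bool" where
  "C_k_on 0 f S \<longleftrightarrow> continuous_on S f"
| "C_k_on (Suc k) f S \<longleftrightarrow>
     (\<forall>x\<in>S. f differentiable (at x)) \<and>
     (\<forall>v. C_k_on k (\<lambda>x. frechet_derivative f (at x) v) S)"

definition smooth_on :: "('a::euclidean_space \<Rightarrow> 'b::real_normed_vector) \<Rightarrow> 'a set \<Rightarrow> bool" where
  "smooth_on f S \<longleftrightarrow> (\<forall>k. C_k_on k f S)"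

text \<open>A chart is a pair of its domain and its coordinate map; the values of the coordinate map
  outside the domain are irrelevant.\<close>

type_synonym ('x, 'e) chart = "'x set \<times> ('x \<Rightarrow> 'e)"

definition transition :: "('x, 'e) chart \<Rightarrow> ('x, 'e) chart \<Rightarrow> 'e \<Rightarrow> 'e" where
  "transition c c' = snd c' \<circ> inv_into (fst c) (snd c)"

definition piecewise_C1_curve ::
    "('x::topological_space, 'e::euclidean_space) chart set \<Rightarrow> (real \<Rightarrow> 'x) \<Rightarrow> bool" where
  "piecewise_C1_curve \<A> \<gamma> \<longleftrightarrow>
     continuous_on {0..1} \<gamma> \<and>
     (\<exists>F. finite F \<and>
        (\<forall>(U, \<phi>)\<in>\<A>. (\<phi> \<circ> \<gamma>) C1_differentiable_on ({0<..<1} \<inter> \<gamma> -` U - F)))"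

text \<open>In a metric \<open>g\<close>, the form \<open>g c y\<close> is the inner product of tangent vectors in the coordinates
  of the chart \<open>c\<close> at the coordinate point \<open>y\<close>. The compatibility of \<open>g\<close> with
  changes of charts makes the speed independent of the chart selected.\<close>

definition curve_speed ::
    "('x, 'e::euclidean_space) chart set \<Rightarrow> (('x, 'e) chart \<Rightarrow> 'e \<Rightarrow> 'e \<Rightarrow> 'e \<Rightarrow> real) \<Rightarrow>
     (real \<Rightarrow> 'x) \<Rightarrow> real \<Rightarrow> real" where
  "curve_speed \<A> g \<gamma> t =
     (let c = (SOME c. c \<in> \<A> \<and> \<gamma> t \<in> fst c);
          v = vector_derivative (snd c \<circ> \<gamma>) (at t)
      in sqrt (g c (snd c (\<gamma> t)) v v))"

text \<open>As in the library's notion of piecewise $C^1$, the derivative may be unbounded near the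
  exceptional points; the length is therefore a nonnegative extended integral, and such curves
  do not change the infimum below.\<close>

definition curve_length ::
    "('x, 'e::euclidean_space) chart set \<Rightarrow> (('x, 'e) chart \<Rightarrow> 'e \<Rightarrow> 'e \<Rightarrow> 'e \<Rightarrow> real) \<Rightarrow>
     (real \<Rightarrow> 'x) \<Rightarrow> ennreal" where
  "curve_length \<A> g \<gamma> = (\<integral>\<^sup>+ t \<in> {0..1}. ennreal (curve_speed \<A> g \<gamma> t) \<partial>lborel)"

text \<open>The value is infinite if there is no curve joining the two points.\<close>

definition riemannian_dist ::
    "('x::topological_space, 'e::euclidean_space) chart set \<Rightarrow>
     (('x, 'e) chart \<Rightarrow> 'e \<Rightarrow> 'e \<Rightarrow> 'e \<Rightarrow> real) \<Rightarrow> 'x \<Rightarrow> 'x \<Rightarrow> ennreal" where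
  "riemannian_dist \<A> g x y =
     (INF \<gamma>\<in>{\<gamma>. piecewise_C1_curve \<A> \<gamma> \<and> \<gamma> 0 = x \<and> \<gamma> 1 = y}. curve_length \<A> g \<gamma>)"

text \<open>Connectedness is not required: the metric of the type is the Riemannian distance on each
  component, while the distance of points in different components is only constrained by
  \<open>dist\<close> being a metric that induces the topology of the manifold. Second countability is part of
  the definition of a manifold (and follows from compactness).\<close>

locale riemannian_manifold =
  fixes \<A> :: "('x::{metric_space, second_countable_topology}, 'e::euclidean_space) chart set"
    and g :: "('x, 'e) chart \<Rightarrow> 'e \<Rightarrow> 'e \<Rightarrow> 'e \<Rightarrow> real"
  assumes charts_cover: "(\<Union>c\<in>\<A>. fst c) = UNIV"
    and chart_domain_open: "(U, \<phi>) \<in> \<A> \<Longrightarrow> open U"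
    and chart_image_open: "(U, \<phi>) \<in> \<A> \<Longrightarrow> open (\<phi> ` U)"
    and chart_homeomorphism:
      "(U, \<phi>) \<in> \<A> \<Longrightarrow> homeomorphism U (\<phi> ` U) \<phi> (inv_into U \<phi>)"
    and transition_smooth:
      "c \<in> \<A> \<Longrightarrow> c' \<in> \<A> \<Longrightarrow> smooth_on (transition c c') (snd c ` (fst c \<inter> fst c'))"
    and metric_bilinear: "(U, \<phi>) \<in> \<A> \<Longrightarrow> y \<in> \<phi> ` U \<Longrightarrow> bilinear (g (U, \<phi>) y)"
    and metric_sym: "(U, \<phi>) \<in> \<A> \<Longrightarrow> y \<in> \<phi> ` U \<Longrightarrow> g (U, \<phi>) y u v = g (U, \<phi>) y v u"
    and metric_pos: "(U, \<phi>) \<in> \<A> \<Longrightarrow> y \<in> \<phi> ` U \<Longrightarrow> v \<noteq> 0 \<Longrightarrow> g (U, \<phi>) y v v > 0"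
    and metric_smooth: "(U, \<phi>) \<in> \<A> \<Longrightarrow> smooth_on (\<lambda>y. g (U, \<phi>) y u v) (\<phi> ` U)"
    and metric_compatible:
      "c \<in> \<A> \<Longrightarrow> c' \<in> \<A> \<Longrightarrow> y \<in> snd c ` (fst c \<inter> fst c') \<Longrightarrow>
       g c y u v = g c' (transition c c' y)
         (frechet_derivative (transition c c') (at y) u)
         (frechet_derivative (transition c c') (at y) v)"
    and dist_eq_riemannian_dist:
      "riemannian_dist \<A> g p q \<noteq> \<infinity> \<Longrightarrow> ennreal (dist p q) = riemannian_dist \<A> g p q"

locale random_dynamical_system = prob_space P
  for P :: "'w::metric_space measure" +
  fixes \<theta> :: "'w \<Rightarrow> 'w"
    and T :: "'w \<Rightarrow> 'x::metric_space \<Rightarrow> 'x"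
  assumes sets_base: "sets P = sets borel"
    and base_measurable: "\<theta> \<in> P \<rightarrow>\<^sub>M P"
    and base_preserving: "distr P P \<theta> = P"
    and maps_measurable: "(\<lambda>(\<omega>, x). T \<omega> x) \<in> P \<Otimes>\<^sub>M borel \<rightarrow>\<^sub>M borel"

fun rds_iterate :: "('w \<Rightarrow> 'w) \<Rightarrow> ('w \<Rightarrow> 'x \<Rightarrow> 'x) \<Rightarrow> nat \<Rightarrow> 'w \<Rightarrow> 'x \<Rightarrow> 'x" where
  "rds_iterate \<theta> T 0 \<omega> x = x"
| "rds_iterate \<theta> T (Suc n) \<omega> x = T ((\<theta> ^^ n) \<omega>) (rds_iterate \<theta> T n \<omega> x)"

definition skew_product :: "('w \<Rightarrow> 'w) \<Rightarrow> ('w \<Rightarrow> 'x \<Rightarrow> 'x) \<Rightarrow> 'w \<times> 'x \<Rightarrow> 'w \<times> 'x" where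
  "skew_product \<theta> T = (\<lambda>(\<omega>, x). (\<theta> \<omega>, T \<omega> x))"

definition stationary_measure ::
    "'w measure \<Rightarrow> ('w \<Rightarrow> 'w) \<Rightarrow> ('w \<Rightarrow> 'x \<Rightarrow> 'x) \<Rightarrow> 'x::metric_space measure \<Rightarrow> bool" where
  "stationary_measure P \<theta> T \<mu> \<longleftrightarrow>
     prob_space \<mu> \<and> sets \<mu> = sets borel \<and>
     distr (P \<Otimes>\<^sub>M \<mu>) (P \<Otimes>\<^sub>M \<mu>) (skew_product \<theta> T) = P \<Otimes>\<^sub>M \<mu>"

definition eln :: "ennreal \<Rightarrow> ereal" where
  "eln a = (if a = \<infinity> then \<infinity> else if a = 0 then - \<infinity> else ereal (ln (enn2real a)))"

definition return_time ::
    "('w \<Rightarrow> 'w) \<Rightarrow> ('w \<Rightarrow> 'x \<Rightarrow> 'x) \<Rightarrow> real \<Rightarrow> nat \<Rightarrow> 'w \<Rightarrow> 'x::metric_space \<Rightarrow> ennreal" where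
  "return_time \<theta> T r p \<omega> x =
     (INF k\<in>{k. p < k \<and> dist (rds_iterate \<theta> T k \<omega> x) x < r}. of_nat k)"

definition annealed_return_time ::
    "'w measure \<Rightarrow> ('w \<Rightarrow> 'w) \<Rightarrow> ('w \<Rightarrow> 'x \<Rightarrow> 'x) \<Rightarrow> real \<Rightarrow> nat \<Rightarrow> 'x::metric_space \<Rightarrow> ennreal" where
  "annealed_return_time P \<theta> T r p x = (\<integral>\<^sup>+ \<omega>. return_time \<theta> T r p \<omega> x \<partial>P)"

text \<open>The quantities below are nondecreasing in \<open>p\<close>, so the limits exist
  (\<open>convergent_recurrence_rates\<close>).\<close>

definition lower_recurrence_rate ::
    "'w measure \<Rightarrow> ('w \<Rightarrow> 'w) \<Rightarrow> ('w \<Rightarrow> 'x \<Rightarrow> 'x) \<Rightarrow> 'x::metric_space \<Rightarrow> ereal" where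
  "lower_recurrence_rate P \<theta> T x =
     lim (\<lambda>p. Liminf (at_right 0)
       (\<lambda>r. eln (annealed_return_time P \<theta> T r p x) / ereal (- ln r)))"

definition upper_recurrence_rate ::
    "'w measure \<Rightarrow> ('w \<Rightarrow> 'w) \<Rightarrow> ('w \<Rightarrow> 'x \<Rightarrow> 'x) \<Rightarrow> 'x::metric_space \<Rightarrow> ereal" where
  "upper_recurrence_rate P \<theta> T x =
     lim (\<lambda>p. Limsup (at_right 0)
       (\<lambda>r. eln (annealed_return_time P \<theta> T r p x) / ereal (- ln r)))"

definition lower_local_dim :: "'x::metric_space measure \<Rightarrow> 'x \<Rightarrow> ereal" where
  "lower_local_dim \<mu> x = Liminf (at_right 0) (\<lambda>r. eln (emeasure \<mu> (ball x r)) / ereal (ln r))"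

definition upper_local_dim :: "'x::metric_space measure \<Rightarrow> 'x \<Rightarrow> ereal" where
  "upper_local_dim \<mu> x = Limsup (at_right 0) (\<lambda>r. eln (emeasure \<mu> (ball x r)) / ereal (ln r))"

lemma eln_mono: "a \<le> b \<Longrightarrow> eln a \<le> eln b"
  by (cases a; cases b) (auto simp: eln_def top_unique ennreal_le_iff)

lemma annealed_return_time_mono:
  "p \<le> q \<Longrightarrow> annealed_return_time P \<theta> T r p x \<le> annealed_return_time P \<theta> T r q x"
  unfolding annealed_return_time_def return_time_def
  by (intro nn_integral_mono INF_superset_mono) auto

lemma convergent_recurrence_rates:
  "convergent (\<lambda>p. Liminf (at_right 0)
     (\<lambda>r. eln (annealed_return_time P \<theta> T r p x) / ereal (- ln r)))" (is ?L)
  "convergent (\<lambda>p. Limsup (at_right 0)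
     (\<lambda>r. eln (annealed_return_time P \<theta> T r p x) / ereal (- ln r)))" (is ?U)
proof -
  have ev: "eventually (\<lambda>r. eln (annealed_return_time P \<theta> T r p x) / ereal (- ln r)
      \<le> eln (annealed_return_time P \<theta> T r q x) / ereal (- ln r)) (at_right 0)"
    if "p \<le> q" for p q
  proof -
    have "eventually (\<lambda>r::real. r \<in> {0<..<1}) (at_right 0)"
      by (rule eventually_at_right_real) simp
    then show ?thesis
    proof eventually_elim
      case (elim r)
      then have "- ln r > 0" by simp
      then show ?case
        by (intro ereal_divide_right_mono eln_mono annealed_return_time_mono that) simp
    qed
  qed
  show ?L
    by (rule convergentI[OF LIMSEQ_SUP])
       (intro monoI Liminf_mono ev)
  show ?U
    by (rule convergentI[OF LIMSEQ_SUP])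
       (intro monoI Limsup_mono ev)
qed

definition lipschitz_function :: "('x::metric_space \<Rightarrow> real) \<Rightarrow> bool" where
  "lipschitz_function f \<longleftrightarrow> (\<exists>L. L-lipschitz_on UNIV f)"

text \<open>Supremum norm plus least Lipschitz constant, for bounded Lipschitz functions.\<close>

definition lipschitz_norm :: "('x::metric_space \<Rightarrow> real) \<Rightarrow> real" where
  "lipschitz_norm f = (SUP x. \<bar>f x\<bar>) + Inf {L. L-lipschitz_on UNIV f}"

definition superpolynomial_decay ::
    "'w measure \<Rightarrow> ('w \<Rightarrow> 'w) \<Rightarrow> ('w \<Rightarrow> 'x \<Rightarrow> 'x) \<Rightarrow> 'x::metric_space measure \<Rightarrow> bool" where
  "superpolynomial_decay P \<theta> T \<mu> \<longleftrightarrow>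
     (\<exists>a :: nat \<Rightarrow> real.
        (\<forall>q>0. (\<lambda>n. a n * real n powr q) \<longlonglongrightarrow> 0) \<and>
        (\<forall>n\<ge>1. \<forall>\<psi> \<phi>. lipschitz_function \<psi> \<longrightarrow> lipschitz_function \<phi> \<longrightarrow>
           \<bar>(\<integral>x. (\<integral>\<omega>. \<psi> (rds_iterate \<theta> T n \<omega> x) * \<phi> x \<partial>P) \<partial>\<mu>)
              - (\<integral>x. \<psi> x \<partial>\<mu>) * (\<integral>x. \<phi> x \<partial>\<mu>)\<bar>
           \<le> lipschitz_norm \<psi> * lipschitz_norm \<phi> * a n))"

end

theory Submission
  imports Defs
begin

text \<open>Write \<open>m x r\<close> for the mass of the ball of radius \<open>r\<close> about \<open>x\<close>, and \<open>t p r x\<close> for the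
  annealed return time to that ball after time \<open>p\<close>. The theorem says that, at almost every \<open>x\<close> of
  positive lower dimension, \<open>t p r x\<close> is of order \<open>1 / m x r\<close> up to factors \<open>r powr \<plusminus>\<epsilon>\<close>, once \<open>p\<close>
  is large; the two bounds have different reasons.

  The upper bound is Kac's lemma for the skew product. The points of a set of measure \<open>m\<close> wait at
  most \<open>1 / m\<close> on average for the next visit, and at most \<open>(p + 1) / m\<close> for the first visit after
  time \<open>p\<close> (\<open>iterated_kac_inequality\<close>, \<open>kac_ball\<close>). Markov's inequality makes this a statement on
  most points of a ball, and Borel--Cantelli over dyadic radii a statement on almost every point
  (\<open>AE_eventually_return_mean_le\<close>).

  The lower bound is decay of correlations. For a point in a ball of radius \<open>r\<close> and a time \<open>k\<close>
  that exceeds a small power of \<open>1 / r\<close>, a super-polynomially small correlation makes a return at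
  time \<open>k\<close> as improbable as the ball is small, even after the loss of the Lipschitz norm of a
  cutoff function and of the number of balls in a cover. Hence no return is expected in the time
  window from \<open>r powr -\<eta>\<close> to \<open>r powr -(a - \<eta>)\<close> if \<open>m x r \<le> r powr a\<close>
  (\<open>AE_summable_window_returns\<close>, \<open>avoiding_windows\<close>). If the lower local dimension is positive,
  the windows of all small radii overlap and cover all large times, so that only finitely many
  early times remain; the delay \<open>p\<close> discards them (\<open>return_mean_lower_estimate\<close>).

  Both arguments pass from a cover by balls to disjoint balls of comparable mass, which requires a
  doubling condition at the centres. It holds, for almost every point, at some scale between \<open>r\<close>
  and \<open>r powr (1 - \<delta>)\<close>, because the mass cannot fall below a power of the radius
  (\<open>AE_eventually_ball_mass_ge\<close>, \<open>doubling_scales\<close>). Exponents do not see such a change of scale.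
  The geometry of the manifold enters only here and in the count of covering balls, through the
  polynomial bound on the size of separated sets (\<open>compact_polynomial_packing\<close>).\<close>

section \<open>Separated sets in compact Riemannian manifolds\<close>

definition separated :: "real \<Rightarrow> 'a::metric_space set \<Rightarrow> bool" where
  "separated r F \<longleftrightarrow> (\<forall>x\<in>F. \<forall>y\<in>F. x \<noteq> y \<longrightarrow> r \<le> dist x y)"

text \<open>Packing is bounded rather than covering because every cover below has its centres in a given
  set: a maximal separated subset of the set is such a cover.\<close>

definition polynomial_packing :: "real \<Rightarrow> nat \<Rightarrow> 'a::metric_space set \<Rightarrow> bool" where
  "polynomial_packing K d S \<longleftrightarrow>
     (\<forall>r F. 0 < r \<longrightarrow> r \<le> 1 \<longrightarrow> F \<subseteq> S \<longrightarrow> separated r F \<longrightarrow>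
        finite F \<and> real (card F) \<le> K * (1 / r) ^ d)"

lemma polynomial_packingD:
  assumes "polynomial_packing K d S" "0 < r" "r \<le> 1" "F \<subseteq> S" "separated r F"
  shows "finite F \<and> real (card F) \<le> K * (1 / r) ^ d"
  using assms unfolding polynomial_packing_def by simp

lemma separated_subset: "separated r F \<Longrightarrow> G \<subseteq> F \<Longrightarrow> separated r G"
  unfolding separated_def by blast

lemma separated_mono: "separated s F \<Longrightarrow> r \<le> s \<Longrightarrow> separated r F"
  unfolding separated_def by (meson order_trans)

lemma disjoint_balls_separated:
  assumes "separated (2 * r) F"
  shows "disjoint_family_on (\<lambda>x. ball x r) F"
proof -
  have False if "x \<in> F" "y \<in> F" "x \<noteq> y" "dist x z < r" "dist y z < r" for x y z
  proof -
    have "2 * r \<le> dist x y"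
      using assms that unfolding separated_def by blast
    also have "\<dots> \<le> dist x z + dist y z"
      by (rule dist_triangle2)
    finally show False using that by linarith
  qed
  then show ?thesis
    unfolding disjoint_family_on_def by (auto simp: mem_ball)
qed

text \<open>Comparison of volumes: the balls of radius \<open>s / 2\<close> about the points are disjoint and lie in
  a ball of radius \<open>R + s / 2\<close>.\<close>

lemma card_separated_euclidean:
  fixes F :: "'e::euclidean_space set"
  assumes "0 < s" "0 \<le> R" "F \<subseteq> cball c R" "separated s F"
  shows "finite F \<and> real (card F) \<le> ((2 * R + s) / s) ^ DIM('e)"
proof -
  have bound: "real (card G) \<le> ((2 * R + s) / s) ^ DIM('e)" if G: "G \<subseteq> F" "finite G" for G
  proof -
    have dis: "disjoint_family_on (\<lambda>x. ball x (s / 2)) G"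
      using disjoint_balls_separated[of "s/2" G] assms(4) G(1) separated_subset by auto
    have sub: "(\<Union>x\<in>G. ball x (s / 2)) \<subseteq> cball c (R + s / 2)"
    proof
      fix z assume "z \<in> (\<Union>x\<in>G. ball x (s / 2))"
      then obtain x where x: "x \<in> G" "dist x z < s / 2" by auto
      have "dist c x \<le> R" using x G assms(3) by auto
      then show "z \<in> cball c (R + s / 2)"
        using x dist_triangle[of c z x] by auto
    qed
    let ?V = "unit_ball_vol (real DIM('e))"
    have "real (card G) * (?V * (s / 2) ^ DIM('e)) = (\<Sum>x\<in>G. measure lborel (ball x (s / 2)))"
      using assms(1) by (simp add: content_ball)
    also have "\<dots> = measure lborel (\<Union>x\<in>G. ball x (s / 2))"
      using G dis emeasure_lborel_ball_finite
      by (intro measure_finite_Union[symmetric]) (auto simp: less_top)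
    also have "\<dots> \<le> measure lborel (cball c (R + s / 2))"
      using sub G emeasure_lborel_cball_finite[of c "R + s / 2"]
      by (intro measure_mono_fmeasurable) (auto intro!: fmeasurableI)
    also have "\<dots> = ?V * (R + s / 2) ^ DIM('e)"
      using assms by (simp add: content_cball)
    finally have "?V * (real (card G) * (s / 2) ^ DIM('e)) \<le> ?V * (R + s / 2) ^ DIM('e)"
      by (simp add: mult_ac)
    moreover have "?V > 0" by simp
    ultimately have "real (card G) * (s / 2) ^ DIM('e) \<le> (R + s / 2) ^ DIM('e)"
      by simp
    then have "real (card G) \<le> (R + s / 2) ^ DIM('e) / (s / 2) ^ DIM('e)"
      using assms(1) by (simp add: pos_le_divide_eq)
    also have "\<dots> = ((R + s / 2) / (s / 2)) ^ DIM('e)"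
      by (rule power_divide[symmetric])
    also have "(R + s / 2) / (s / 2) = (2 * R + s) / s"
      using assms(1) by (simp add: field_simps)
    finally show ?thesis .
  qed
  have "finite F \<and> card F \<le> nat \<lfloor>((2 * R + s) / s) ^ DIM('e)\<rfloor>"
  proof (rule finite_if_finite_subsets_card_bdd)
    fix G assume "G \<subseteq> F" "finite G"
    from bound[OF this] show "card G \<le> nat \<lfloor>((2 * R + s) / s) ^ DIM('e)\<rfloor>"
      by (simp add: le_nat_floor)
  qed
  then show ?thesis using bound by blast
qed

context riemannian_manifold
begin

lemma metric_bounded_on_compact:
  assumes c: "(U, \<phi>) \<in> \<A>" and Q: "compact Q" "Q \<subseteq> \<phi> ` U"
  obtains M where "0 < M" "\<And>y u. y \<in> Q \<Longrightarrow> g (U, \<phi>) y u u \<le> M\<^sup>2 * (norm u)\<^sup>2"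
proof -
  have "\<exists>B. \<forall>y\<in>Q. \<bar>g (U, \<phi>) y i j\<bar> \<le> B" for i j
  proof -
    have "C_k_on 0 (\<lambda>y. g (U, \<phi>) y i j) (\<phi> ` U)"
      using metric_smooth[OF c] unfolding smooth_on_def by blast
    then have "continuous_on Q (\<lambda>y. g (U, \<phi>) y i j)"
      using Q continuous_on_subset by auto
    then have "bounded ((\<lambda>y. g (U, \<phi>) y i j) ` Q)"
      using Q compact_continuous_image compact_imp_bounded by blast
    then show ?thesis unfolding bounded_iff by auto
  qed
  then obtain B where B: "\<And>i j y. y \<in> Q \<Longrightarrow> \<bar>g (U, \<phi>) y i j\<bar> \<le> B i j"
    by metis
  define S where "S = (\<Sum>(i, j)\<in>Basis \<times> (Basis :: 'e set). \<bar>B i j\<bar>)"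
  have S0: "S \<ge> 0" unfolding S_def by (intro sum_nonneg) auto
  have "g (U, \<phi>) y u u \<le> S * (norm u)\<^sup>2" if y: "y \<in> Q" for y u
  proof -
    have bil: "bilinear (g (U, \<phi>) y)" using metric_bilinear[OF c] y Q by auto
    have "g (U, \<phi>) y u u
        = g (U, \<phi>) y (\<Sum>b\<in>Basis. (u \<bullet> b) *\<^sub>R b) (\<Sum>b\<in>Basis. (u \<bullet> b) *\<^sub>R b)"
      by (simp add: euclidean_representation)
    also have "\<dots> = (\<Sum>(i, j)\<in>Basis \<times> Basis. g (U, \<phi>) y ((u \<bullet> i) *\<^sub>R i) ((u \<bullet> j) *\<^sub>R j))"
      by (rule bilinear_sum[OF bil])
    also have "\<dots> = (\<Sum>(i, j)\<in>Basis \<times> Basis. (u \<bullet> i) * (u \<bullet> j) * g (U, \<phi>) y i j)"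
      by (intro sum.cong) (auto simp: bilinear_lmul[OF bil] bilinear_rmul[OF bil])
    also have "\<dots> \<le> (\<Sum>(i, j)\<in>Basis \<times> (Basis :: 'e set). \<bar>B i j\<bar> * (norm u)\<^sup>2)"
    proof (intro sum_mono, clarify)
      fix i j :: 'e assume b: "i \<in> Basis" "j \<in> Basis"
      have "(u \<bullet> i) * (u \<bullet> j) * g (U, \<phi>) y i j
          \<le> \<bar>u \<bullet> i\<bar> * \<bar>u \<bullet> j\<bar> * \<bar>g (U, \<phi>) y i j\<bar>"
        by (metis abs_ge_self abs_mult)
      also have "\<dots> \<le> norm u * norm u * \<bar>B i j\<bar>"
        using b B[OF y, of i j] by (intro mult_mono) (auto simp: Basis_le_norm)
      finally show "(u \<bullet> i) * (u \<bullet> j) * g (U, \<phi>) y i j \<le> \<bar>B i j\<bar> * (norm u)\<^sup>2"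
        by (simp add: power2_eq_square mult_ac)
    qed
    also have "\<dots> = S * (norm u)\<^sup>2"
      unfolding S_def by (simp add: sum_distrib_right case_prod_unfold)
    finally show ?thesis .
  qed
  moreover have "S \<le> (S + 1)\<^sup>2" using S0 by (simp add: power2_eq_square algebra_simps)
  ultimately have "g (U, \<phi>) y u u \<le> (S + 1)\<^sup>2 * (norm u)\<^sup>2" if "y \<in> Q" for y u
    using that by (meson mult_right_mono order_trans zero_le_power2)
  then show ?thesis using that[of "S + 1"] S0 by simp
qed

lemma transition_has_derivative:
  assumes "c \<in> \<A>" "c' \<in> \<A>" "y \<in> snd c ` (fst c \<inter> fst c')"
  shows "(transition c c' has_derivative frechet_derivative (transition c c') (at y)) (at y)"
proof -
  have "C_k_on (Suc 0) (transition c c') (snd c ` (fst c \<inter> fst c'))"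
    using transition_smooth assms unfolding smooth_on_def by blast
  then have "transition c c' differentiable at y"
    using assms(3) by (simp del: image_Int ball_simps) blast
  then show ?thesis by (simp add: frechet_derivative_works)
qed

lemma continuous_on_transition_derivative:
  assumes "c \<in> \<A>" "c' \<in> \<A>"
  shows "continuous_on (snd c ` (fst c \<inter> fst c'))
           (\<lambda>y. frechet_derivative (transition c c') (at y) v)"
proof -
  have "C_k_on (Suc 0) (transition c c') (snd c ` (fst c \<inter> fst c'))"
    using transition_smooth assms unfolding smooth_on_def by blast
  then show ?thesis by simp
qed

text \<open>The preimage in \<open>U\<close> of a straight segment in coordinates is an admissible curve, and its
  length bounds the distance of its ends. Its speed may be computed in the one chart \<open>U\<close>,
  whichever chart the definition of speed selects, since \<open>g\<close> is compatible with transitions.\<close>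

lemma dist_le_chart_segment:
  assumes c: "(U, \<phi>) \<in> \<A>" and Q: "convex Q" "Q \<subseteq> \<phi> ` U"
    and M: "0 \<le> M" "\<And>y u. y \<in> Q \<Longrightarrow> g (U, \<phi>) y u u \<le> M\<^sup>2 * (norm u)\<^sup>2"
    and pq: "p \<in> U" "q \<in> U" "\<phi> p \<in> Q" "\<phi> q \<in> Q"
  shows "dist p q \<le> M * norm (\<phi> q - \<phi> p)"
proof -
  define w where "w = \<phi> q - \<phi> p"
  define l where "l t = \<phi> p + t *\<^sub>R w" for t :: real
  define \<gamma> where "\<gamma> = inv_into U \<phi> \<circ> l"
  have hom: "homeomorphism U (\<phi> ` U) \<phi> (inv_into U \<phi>)"
    using chart_homeomorphism[OF c] .
  have lQ: "l t \<in> Q" if "t \<in> {0..1}" for t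
  proof -
    have "l t = (1 - t) *\<^sub>R \<phi> p + t *\<^sub>R \<phi> q"
      by (simp add: l_def w_def algebra_simps)
    then show ?thesis using convexD[OF Q(1) pq(3,4), of "1 - t" t] that by simp
  qed
  have lder: "(l has_vector_derivative w) (at t)" for t
    unfolding l_def by (auto intro!: derivative_eq_intros)
  have contl: "continuous_on A l" for A
    unfolding l_def by (intro continuous_intros)
  have \<gamma>U: "\<gamma> t \<in> U" "\<phi> (\<gamma> t) = l t" if "t \<in> {0..1}" for t
    using lQ[OF that] Q(2) by (auto simp: \<gamma>_def inv_into_into f_inv_into_f)
  have ends: "\<gamma> 0 = p" "\<gamma> 1 = q"
    using hom pq unfolding homeomorphism_def by (auto simp: \<gamma>_def l_def w_def)
  \<comment> \<open>By definition of the transition maps, this holds with no condition on the domains.\<close>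
  have coord: "snd c' \<circ> \<gamma> = transition (U, \<phi>) c' \<circ> l" for c'
    by (simp add: transition_def \<gamma>_def o_assoc)
  have l_overlap: "l t \<in> snd (U, \<phi>) ` (fst (U, \<phi>) \<inter> fst c')"
    if "t \<in> {0..1}" "\<gamma> t \<in> fst c'" for t c'
    using \<gamma>U[OF that(1)] that(2) by (auto intro!: image_eqI[of _ _ "\<gamma> t"])
  have deriv: "((snd c' \<circ> \<gamma>) has_vector_derivative
      frechet_derivative (transition (U, \<phi>) c') (at (l t)) w) (at t)"
    if "c' \<in> \<A>" "t \<in> {0..1}" "\<gamma> t \<in> fst c'" for t c'
    unfolding coord
    by (rule vector_derivative_diff_chain_within[of l w t UNIV, simplified])
       (use lder transition_has_derivative[OF c that(1) l_overlap[OF that(2,3)]]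
         in \<open>auto intro: has_derivative_at_withinI\<close>)
  have "piecewise_C1_curve \<A> \<gamma>"
    unfolding piecewise_C1_curve_def
  proof (rule conjI, goal_cases)
    case 1
    have "continuous_on (l ` {0..1}) (inv_into U \<phi>)"
    proof (rule continuous_on_subset)
      show "continuous_on (\<phi> ` U) (inv_into U \<phi>)"
        using hom unfolding homeomorphism_def by blast
      show "l ` {0..1} \<subseteq> \<phi> ` U" using lQ Q(2) by blast
    qed
    then show "continuous_on {0..1} \<gamma>"
      unfolding \<gamma>_def by (intro continuous_on_compose contl)
  next
    case 2
    have "(\<xi> \<circ> \<gamma>) C1_differentiable_on ({0<..<1} \<inter> \<gamma> -` V - {})"
      if c': "(V, \<xi>) \<in> \<A>" for V \<xi>
      proof -
        have "continuous_on ({0<..<1} \<inter> \<gamma> -` V)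
            (\<lambda>t. frechet_derivative (transition (U, \<phi>) (V, \<xi>)) (at (l t)) w)"
          using l_overlap[of _ "(V, \<xi>)"]
          by (intro continuous_on_compose2[OF continuous_on_transition_derivative[OF c c'] contl]) auto
        then show ?thesis
          unfolding C1_differentiable_on_def using deriv[OF c']
          by (intro exI[of _ "\<lambda>t. frechet_derivative (transition (U, \<phi>) (V, \<xi>)) (at (l t)) w"]) auto
      qed
    then show ?case by blast
  qed
  moreover have "curve_length \<A> g \<gamma> \<le> ennreal (M * norm w)"
  proof -
    have speed: "curve_speed \<A> g \<gamma> t \<le> M * norm w" if t: "t \<in> {0..1}" for t
    proof -
      define c' where "c' = (SOME c. c \<in> \<A> \<and> \<gamma> t \<in> fst c)"
      have "\<exists>c. c \<in> \<A> \<and> \<gamma> t \<in> fst c" using c \<gamma>U[OF t] by auto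
      then have c': "c' \<in> \<A>" "\<gamma> t \<in> fst c'"
        unfolding c'_def by (metis (mono_tags, lifting) someI_ex)+
      have "curve_speed \<A> g \<gamma> t = sqrt (g c' (transition (U, \<phi>) c' (l t))
          (frechet_derivative (transition (U, \<phi>) c') (at (l t)) w)
          (frechet_derivative (transition (U, \<phi>) c') (at (l t)) w))"
        using vector_derivative_at[OF deriv[OF c'(1) t c'(2)]] fun_cong[OF coord[of c'], of t]
        by (simp add: curve_speed_def Let_def c'_def)
      also have "\<dots> = sqrt (g (U, \<phi>) (l t) w w)"
        using metric_compatible[OF c c'(1) l_overlap[OF t c'(2)], of w w] by simp
      also have "\<dots> \<le> sqrt (M\<^sup>2 * (norm w)\<^sup>2)"
        using M(2)[OF lQ[OF t]] by simp
      also have "\<dots> = M * norm w"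
        using M(1) by (simp add: real_sqrt_mult)
      finally show ?thesis .
    qed
    have "curve_length \<A> g \<gamma> \<le> (\<integral>\<^sup>+ (t :: real). ennreal (M * norm w) * indicator {0..1} t \<partial>lborel)"
      unfolding curve_length_def
      by (rule nn_integral_mono) (use speed in \<open>auto simp: indicator_def intro!: ennreal_leI\<close>)
    also have "\<dots> = ennreal (M * norm w)"
      by (simp add: nn_integral_cmult)
    finally show ?thesis .
  qed
  ultimately have rd: "riemannian_dist \<A> g p q \<le> ennreal (M * norm w)"
    unfolding riemannian_dist_def using ends by (intro INF_lower2[of \<gamma>]) auto
  then have "riemannian_dist \<A> g p q \<noteq> \<infinity>"
    by (metis ennreal_neq_top infinity_ennreal_def top.extremum_unique)
  from dist_eq_riemannian_dist[OF this] rd have "ennreal (dist p q) \<le> ennreal (M * norm w)"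
    by simp
  then show ?thesis using M(1) by (simp add: w_def ennreal_le_iff)
qed

text \<open>Near \<open>x\<close>, distances are at most a constant times the coordinate distances. So separated
  points have separated coordinates, and these lie in a Euclidean ball.\<close>

lemma local_polynomial_packing:
  fixes x :: 'x
  obtains V K where "open V" "x \<in> V" "polynomial_packing K DIM('e) V"
proof -
  obtain U \<phi> where c: "(U, \<phi>) \<in> \<A>" and x: "x \<in> U"
    using charts_cover by (metis UNIV_I UN_E prod.collapse)
  have hom: "homeomorphism U (\<phi> ` U) \<phi> (inv_into U \<phi>)"
    using chart_homeomorphism[OF c] .
  obtain e where e: "0 < e" "cball (\<phi> x) e \<subseteq> \<phi> ` U"
    using chart_image_open[OF c] x open_contains_cball by (metis imageI)
  obtain M where M: "0 < M" "\<And>y u. y \<in> cball (\<phi> x) e \<Longrightarrow> g (U, \<phi>) y u u \<le> M\<^sup>2 * (norm u)\<^sup>2"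
    using metric_bounded_on_compact[OF c compact_cball e(2)] by blast
  define V where "V = U \<inter> \<phi> -` ball (\<phi> x) e"
  have "open V"
    unfolding V_def using hom chart_domain_open[OF c]
    by (intro continuous_open_preimage) (auto simp: homeomorphism_def)
  moreover have "x \<in> V" using x e by (simp add: V_def)
  moreover have "polynomial_packing ((2 * e * M + 1) ^ DIM('e)) DIM('e) V"
    unfolding polynomial_packing_def
  proof (intro allI impI)
    fix r :: real and F assume r: "0 < r" "r \<le> 1" and F: "F \<subseteq> V" "separated r F"
    have lip: "dist p q \<le> M * norm (\<phi> q - \<phi> p)" if "p \<in> F" "q \<in> F" for p q
      by (rule dist_le_chart_segment[OF c _ e(2)]) (use M that F in \<open>auto simp: V_def\<close>)
    have "inj_on \<phi> U" using hom unfolding homeomorphism_def by (metis inj_on_inverseI)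
    then have inj: "inj_on \<phi> F" by (rule inj_on_subset) (use F in \<open>auto simp: V_def\<close>)
    have "separated (r / M) (\<phi> ` F)"
      unfolding separated_def
    proof clarify
      fix p q assume pq: "p \<in> F" "q \<in> F" "\<phi> p \<noteq> \<phi> q"
      then have "p \<noteq> q" by auto
      then have "r \<le> dist p q" using F(2) pq unfolding separated_def by simp
      also have "\<dots> \<le> M * dist (\<phi> p) (\<phi> q)"
        using lip[OF pq(1,2)] by (simp add: dist_norm norm_minus_commute)
      finally show "r / M \<le> dist (\<phi> p) (\<phi> q)"
        using M(1) by (simp add: pos_divide_le_eq mult.commute)
    qed
    moreover have "\<phi> ` F \<subseteq> cball (\<phi> x) e" using F(1) by (auto simp: V_def)
    ultimately have "finite (\<phi> ` F) \<and>
        real (card (\<phi> ` F)) \<le> ((2 * e + r / M) / (r / M)) ^ DIM('e)"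
      using r M(1) e(1) by (intro card_separated_euclidean) auto
    then have fin: "finite F" and card: "real (card F) \<le> ((2 * e + r / M) / (r / M)) ^ DIM('e)"
      using inj by (auto simp: finite_image_iff card_image)
    have "(2 * e + r / M) / (r / M) = (2 * e * M + r) * (1 / r)"
      using M(1) r(1) by (simp add: field_simps)
    also have "\<dots> \<le> (2 * e * M + 1) * (1 / r)"
      using r by (intro mult_right_mono) auto
    finally have "((2 * e + r / M) / (r / M)) ^ DIM('e) \<le> ((2 * e * M + 1) * (1 / r)) ^ DIM('e)"
      using M(1) e(1) r(1) by (intro power_mono) auto
    then have "real (card F) \<le> (2 * e * M + 1) ^ DIM('e) * (1 / r) ^ DIM('e)"
      using card unfolding power_mult_distrib by linarith
    with fin show "finite F \<and> real (card F) \<le> (2 * e * M + 1) ^ DIM('e) * (1 / r) ^ DIM('e)"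
      by blast
  qed
  ultimately show ?thesis using that by blast
qed

lemma compact_polynomial_packing:
  assumes "compact (UNIV :: 'x set)"
  obtains K where "polynomial_packing K DIM('e) (UNIV :: 'x set)"
proof -
  have "\<forall>x :: 'x. \<exists>p. open (fst p) \<and> x \<in> fst p \<and> polynomial_packing (snd p) DIM('e) (fst p)"
    using local_polynomial_packing by (metis fst_conv snd_conv)
  from choice[OF this] obtain f :: "'x \<Rightarrow> 'x set \<times> real"
    where f: "\<And>x. open (fst (f x)) \<and> x \<in> fst (f x)
      \<and> polynomial_packing (snd (f x)) DIM('e) (fst (f x))"
    by blast
  define V where "V = fst \<circ> f"
  define K where "K = snd \<circ> f"
  have VK: "open (V x)" "x \<in> V x" "polynomial_packing (K x) DIM('e) (V x)" for x
    using f[of x] by (simp_all add: V_def K_def)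
  obtain I where I: "finite I" "UNIV \<subseteq> (\<Union>x\<in>I. V x)"
    by (rule compactE_image[OF assms, of UNIV V]) (use VK(1,2) in auto)
  have "polynomial_packing (\<Sum>x\<in>I. K x) DIM('e) (UNIV :: 'x set)"
    unfolding polynomial_packing_def
  proof (intro allI impI)
    fix r :: real and F :: "'x set"
    assume r: "0 < r" "r \<le> 1" and F: "separated r F"
    have FV: "finite (F \<inter> V x) \<and> real (card (F \<inter> V x)) \<le> K x * (1 / r) ^ DIM('e)" for x
      using polynomial_packingD[OF VK(3) r] separated_subset[OF F, of "F \<inter> V x"] by blast
    have eq: "F = (\<Union>x\<in>I. F \<inter> V x)" using I(2) by blast
    then have fin: "finite F" using FV I(1) by (metis finite_UN)
    have "card F \<le> (\<Sum>x\<in>I. card (F \<inter> V x))"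
      using card_UN_le[OF I(1), of "\<lambda>x. F \<inter> V x"] eq by simp
    then have "real (card F) \<le> (\<Sum>x\<in>I. real (card (F \<inter> V x)))"
      by (metis of_nat_le_iff of_nat_sum)
    also have "\<dots> \<le> (\<Sum>x\<in>I. K x * (1 / r) ^ DIM('e))"
      using FV by (intro sum_mono) blast
    finally show "finite F \<and> real (card F) \<le> (\<Sum>x\<in>I. K x) * (1 / r) ^ DIM('e)"
      using fin by (simp add: sum_distrib_right)
  qed
  then show ?thesis using that by blast
qed

end

text \<open>The bound on cardinalities provides a separated subset with most elements; no further point
  of \<open>A\<close> can be far from all of them.\<close>

lemma polynomial_packing_maximal:
  fixes A :: "'a::metric_space set"
  assumes "polynomial_packing K d (UNIV :: 'a set)" "0 < r"
  obtains F where "F \<subseteq> A" "finite F" "separated r F" "A \<subseteq> (\<Union>x\<in>F. ball x r)"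
proof -
  define s where "s = min r 1"
  have s: "0 < s" "s \<le> 1" "s \<le> r" using assms(2) by (auto simp: s_def)
  let ?P = "\<lambda>F. F \<subseteq> A \<and> separated r F"
  have card: "finite F \<and> real (card F) \<le> K * (1 / s) ^ d" if "?P F" for F
    using polynomial_packingD[OF assms(1) s(1,2) subset_UNIV]
      separated_mono[OF conjunct2[OF that] s(3)] by blast
  have "\<exists>n. (\<exists>F. ?P F \<and> card F = n) \<and> (\<forall>m. (\<exists>F. ?P F \<and> card F = m) \<longrightarrow> m \<le> n)"
  proof (rule Nat.ex_has_greatest_nat[where k = 0 and b = "nat \<lfloor>K * (1 / s) ^ d\<rfloor>"])
    show "\<exists>F. ?P F \<and> card F = 0"
      by (rule exI[of _ "{}"]) (simp add: separated_def)
    show "\<forall>m. (\<exists>F. ?P F \<and> card F = m) \<longrightarrow> m \<le> nat \<lfloor>K * (1 / s) ^ d\<rfloor>"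
      using card by (auto intro!: le_nat_floor)
  qed
  then obtain F where F: "?P F" and max: "\<And>G. ?P G \<Longrightarrow> card G \<le> card F" by blast
  have "y \<in> (\<Union>x\<in>F. ball x r)" if y: "y \<in> A" for y
  proof (rule ccontr)
    assume "y \<notin> (\<Union>x\<in>F. ball x r)"
    then have far: "\<And>x. x \<in> F \<Longrightarrow> r \<le> dist x y" by force
    then have "separated r (insert y F)"
      using F unfolding separated_def by (auto simp: dist_commute)
    then have "card (insert y F) \<le> card F" using max y F by blast
    moreover have "y \<notin> F" using far[of y] assms(2) by auto
    ultimately show False using card[OF F] by simp
  qed
  then show ?thesis using that[of F] F card[OF F] by blast
qed

section \<open>Kac inequality for annealed return times\<close>

text \<open>The sum is the integral over \<open>B\<close> of the first visit time after \<open>p\<close>. By invariance, its terms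
  up to \<open>N\<close> may be pulled back to the common final time \<open>N\<close>: the \<open>n\<close>-th one becomes the
  probability that the orbit is in \<open>B\<close> at time \<open>N - n\<close> and not again from \<open>p + 1\<close> steps later up
  to \<open>N\<close>. For one orbit, this occurs for at most \<open>p + 1\<close> values of \<open>n\<close>, those close to its last
  visit.\<close>

lemma iterated_kac_inequality:
  assumes "prob_space M" and S: "S \<in> M \<rightarrow>\<^sub>M M" "distr M M S = M" and B[measurable]: "B \<in> sets M"
  shows "(\<Sum>n. emeasure M {z\<in>space M. z \<in> B \<and> (\<forall>k\<in>{p<..n}. (S ^^ k) z \<notin> B)}) \<le> of_nat (p + 1)"
proof (rule suminf_le_const[OF summableI])
  fix N
  interpret prob_space M by fact
  have Sn[measurable]: "(S ^^ k) \<in> M \<rightarrow>\<^sub>M M" for k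
    using S(1) by (rule measurable_compose_n)
  have pres: "distr M M (S ^^ k) = M" for k
  proof (induction k)
    case 0
    then show ?case by (simp add: id_def)
  next
    case (Suc k)
    have "distr M M (S \<circ> S ^^ k) = distr (distr M M (S ^^ k)) M S"
      by (rule distr_distr[symmetric]) (use S in auto)
    then show ?case using Suc S(2) by (simp add: comp_def)
  qed
  define E where "E n = {z\<in>space M. z \<in> B \<and> (\<forall>k\<in>{p<..n}. (S ^^ k) z \<notin> B)}" for n
  have E[measurable]: "E n \<in> sets M" for n unfolding E_def by measurable
  have count: "(\<Sum>n<N. indicator (E n) ((S ^^ (N - n)) z)) \<le> (of_nat (p + 1) :: ennreal)" for z
  proof -
    define I where "I = {n. n < N \<and> (S ^^ (N - n)) z \<in> E n}"
    have "card I \<le> p + 1"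
    proof (cases "I = {}")
      case False
      have fin: "finite I" by (simp add: I_def)
      \<comment> \<open>\<open>N - a\<close> is the time of the last visit that counts.\<close>
      define a where "a = Min I"
      have a: "a \<in> I" using False fin by (simp add: a_def)
      have "n \<in> {a..a + p}" if n: "n \<in> I" for n
      proof -
        have an: "a \<le> n" using n fin by (simp add: a_def)
        have "\<not> p < n - a"
        proof
          assume "p < n - a"
          then have "(S ^^ (n - a)) ((S ^^ (N - n)) z) \<notin> B"
            using n by (auto simp: I_def E_def)
          moreover have "(S ^^ (n - a)) ((S ^^ (N - n)) z) = (S ^^ (N - a)) z"
            using an n by (simp add: I_def funpow_add[symmetric, THEN fun_cong, simplified])
          ultimately show False using a by (simp add: I_def E_def)
        qed
        then show ?thesis using an by auto
      qed
      then have "card I \<le> card {a..a + p}" by (intro card_mono) auto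
      then show ?thesis by simp
    qed simp
    moreover have "(\<Sum>n<N. indicator (E n) ((S ^^ (N - n)) z)) = (of_nat (card I) :: ennreal)"
    proof -
      have "(\<Sum>n<N. indicator (E n) ((S ^^ (N - n)) z)) = (\<Sum>n<N. indicator I n :: ennreal)"
        by (intro sum.cong) (auto simp: I_def indicator_def)
      also have "\<dots> = (\<Sum>n\<in>I. 1)"
        by (rule sum.mono_neutral_cong_right) (auto simp: I_def indicator_def)
      finally show ?thesis by simp
    qed
    ultimately show ?thesis by (simp only: of_nat_le_iff)
  qed
  have "(\<Sum>n<N. emeasure M (E n)) = (\<Sum>n<N. \<integral>\<^sup>+z. indicator (E n) ((S ^^ (N - n)) z) \<partial>M)"
  proof (intro sum.cong refl)
    fix n
    have "emeasure M (E n) = (\<integral>\<^sup>+z. indicator (E n) z \<partial>distr M M (S ^^ (N - n)))"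
      by (simp add: pres)
    also have "\<dots> = (\<integral>\<^sup>+z. indicator (E n) ((S ^^ (N - n)) z) \<partial>M)"
      by (rule nn_integral_distr) auto
    finally show "emeasure M (E n) = (\<integral>\<^sup>+z. indicator (E n) ((S ^^ (N - n)) z) \<partial>M)" .
  qed
  also have "\<dots> = (\<integral>\<^sup>+z. (\<Sum>n<N. indicator (E n) ((S ^^ (N - n)) z)) \<partial>M)"
    by (rule nn_integral_sum[symmetric]) auto
  also have "\<dots> \<le> (\<integral>\<^sup>+z. of_nat (p + 1) \<partial>M)"
    by (rule nn_integral_mono) (rule count)
  also have "\<dots> = of_nat (p + 1)" by (simp add: emeasure_space_1)
  finally show "(\<Sum>n<N. emeasure M {z\<in>space M. z \<in> B \<and> (\<forall>k\<in>{p<..n}. (S ^^ k) z \<notin> B)})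
      \<le> of_nat (p + 1)"
    by (simp add: E_def)
qed

locale stationary_rds = random_dynamical_system P \<theta> T
  for P :: "'w::metric_space measure" and \<theta> :: "'w \<Rightarrow> 'w"
    and T :: "'w \<Rightarrow> 'x::{metric_space, second_countable_topology} \<Rightarrow> 'x" +
  fixes \<mu> :: "'x measure"
  assumes stationary: "stationary_measure P \<theta> T \<mu>"
begin

abbreviation orbit :: "nat \<Rightarrow> 'w \<Rightarrow> 'x \<Rightarrow> 'x" where
  "orbit \<equiv> rds_iterate \<theta> T"

abbreviation return_mean :: "real \<Rightarrow> nat \<Rightarrow> 'x \<Rightarrow> ennreal" where
  "return_mean \<equiv> annealed_return_time P \<theta> T"

sublocale mu: prob_space \<mu>
  using stationary unfolding stationary_measure_def by blast

sublocale pair: pair_prob_space P \<mu> ..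

lemma sets_mu[simp, measurable_cong]: "sets \<mu> = sets borel"
  using stationary unfolding stationary_measure_def by blast

lemma space_mu[simp]: "space \<mu> = UNIV"
  using sets_eq_imp_space_eq[OF sets_mu] by simp

lemma space_P[simp]: "space P = UNIV"
  using sets_eq_imp_space_eq[OF sets_base] by simp

lemma measurable_ident_mu[simp]: "(\<lambda>x. x) \<in> \<mu> \<rightarrow>\<^sub>M borel"
  by (rule measurable_ident_sets) simp

lemma measurable_orbit[measurable (raw)]:
  assumes [measurable]: "f \<in> M \<rightarrow>\<^sub>M P" "h \<in> M \<rightarrow>\<^sub>M borel"
  shows "(\<lambda>z. orbit n (f z) (h z)) \<in> M \<rightarrow>\<^sub>M borel"
proof (induction n)
  case (Suc n)
  have [measurable]: "(\<theta> ^^ n) \<in> P \<rightarrow>\<^sub>M P"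
    using base_measurable by (rule measurable_compose_n)
  have "(\<lambda>z. ((\<theta> ^^ n) (f z), orbit n (f z) (h z))) \<in> M \<rightarrow>\<^sub>M P \<Otimes>\<^sub>M borel"
    using Suc by measurable
  from measurable_compose[OF this maps_measurable] show ?case by simp
qed (use assms in simp)

lemma skew_product_iterate:
  "(skew_product \<theta> T ^^ k) (\<omega>, x) = ((\<theta> ^^ k) \<omega>, orbit k \<omega> x)"
  by (induction k) (auto simp: skew_product_def)

lemma skew_product_measurable: "skew_product \<theta> T \<in> P \<Otimes>\<^sub>M \<mu> \<rightarrow>\<^sub>M P \<Otimes>\<^sub>M \<mu>"
proof -
  have [measurable]: "\<theta> \<in> P \<rightarrow>\<^sub>M P" by (rule base_measurable)
  have "(\<lambda>z. (\<theta> (fst z), orbit 1 (fst z) (snd z))) \<in> P \<Otimes>\<^sub>M \<mu> \<rightarrow>\<^sub>M P \<Otimes>\<^sub>M \<mu>"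
    by measurable
  then show ?thesis by (simp add: skew_product_def case_prod_unfold)
qed

text \<open>The events are stated for sets of times, since returns in an interval and in a single
  instant both occur.\<close>

definition avoiding :: "real \<Rightarrow> nat set \<Rightarrow> 'x \<Rightarrow> 'w set" where
  "avoiding r I x = {\<omega>. \<forall>k\<in>I. r \<le> dist (orbit k \<omega> x) x}"

lemma avoiding_measurable[measurable]: "avoiding r I x \<in> sets P"
proof -
  have "{\<omega>\<in>space P. \<forall>k\<in>I. r \<le> dist (orbit k \<omega> x) x} \<in> sets P"
    by measurable
  then show ?thesis by (simp add: avoiding_def)
qed

lemma avoiding_antimono: "I \<subseteq> J \<Longrightarrow> r \<le> s \<Longrightarrow> avoiding s J x \<subseteq> avoiding r I x"
  unfolding avoiding_def by force

lemma measurable_prob_avoiding[measurable (raw)]: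
  assumes "f \<in> M \<rightarrow>\<^sub>M borel"
  shows "(\<lambda>z. emeasure P (avoiding r I (f z))) \<in> borel_measurable M"
proof -
  have "(\<lambda>x. emeasure P (Pair x -` {z \<in> space (borel \<Otimes>\<^sub>M P).
      \<forall>k\<in>I. r \<le> dist (orbit k (snd z) (fst z)) (fst z)})) \<in> borel_measurable borel"
    by (rule measurable_emeasure_Pair) measurable
  then have "(\<lambda>x. emeasure P (avoiding r I x)) \<in> borel_measurable borel"
    by (simp add: avoiding_def space_pair_measure vimage_def)
  with assms show ?thesis by (rule measurable_compose)
qed

text \<open>The expectation of a natural number is the sum of its tails; an orbit that never returns
  contributes to every term.\<close>

lemma return_mean_eq_suminf: "return_mean r p x = (\<Sum>n. emeasure P (avoiding r {p<..n} x))"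
proof -
  have "return_time \<theta> T r p \<omega> x = (\<Sum>n. indicator (avoiding r {p<..n} x) \<omega>)" for \<omega>
  proof (cases "\<exists>k. p < k \<and> dist (orbit k \<omega> x) x < r")
    case True
    define K where "K = (LEAST k. p < k \<and> dist (orbit k \<omega> x) x < r)"
    have K: "p < K" "dist (orbit K \<omega> x) x < r"
      using LeastI_ex[OF True] by (auto simp: K_def)
    have K_le: "K \<le> k" if "p < k" "dist (orbit k \<omega> x) x < r" for k
      unfolding K_def by (rule Least_le) (use that in simp)
    have "return_time \<theta> T r p \<omega> x = of_nat K"
      unfolding return_time_def
      by (rule antisym) (auto intro!: INF_lower INF_greatest K simp: K_le)
    also have "\<dots> = (\<Sum>n<K. 1)" by simp
    also have "\<dots> = (\<Sum>n. indicator (avoiding r {p<..n} x) \<omega>)"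
    proof -
      have "\<omega> \<in> avoiding r {p<..n} x \<longleftrightarrow> n < K" for n
      proof
        assume "\<omega> \<in> avoiding r {p<..n} x"
        then have "r \<le> dist (orbit k \<omega> x) x" if "k \<in> {p<..n}" for k
          using that by (simp add: avoiding_def)
        from this[of K] show "n < K" using K by (cases "n < K") auto
      next
        assume n: "n < K"
        have "r \<le> dist (orbit k \<omega> x) x" if "k \<in> {p<..n}" for k
          using K_le[of k] that n by (cases "r \<le> dist (orbit k \<omega> x) x") auto
        then show "\<omega> \<in> avoiding r {p<..n} x" by (simp add: avoiding_def)
      qed
      then have "indicator (avoiding r {p<..n} x) \<omega> = (if n < K then 1 else 0 :: ennreal)" for n
        by (simp add: indicator_def)
      moreover have "(\<Sum>n. if n < K then 1 else 0 :: ennreal) = (\<Sum>n<K. if n < K then 1 else 0)"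
        by (rule suminf_finite) auto
      ultimately show ?thesis by simp
    qed
    finally show ?thesis .
  next
    case False
    then have "{k. p < k \<and> dist (orbit k \<omega> x) x < r} = {}" by simp
    then have "return_time \<theta> T r p \<omega> x = \<top>"
      unfolding return_time_def by simp
    moreover have "indicator (avoiding r {p<..n} x) \<omega> = (1 :: ennreal)" for n
    proof -
      have "r \<le> dist (orbit k \<omega> x) x" if "p < k" for k
        using False that by (meson not_le)
      then show ?thesis by (simp add: avoiding_def indicator_def)
    qed
    moreover have "(\<Sum>n :: nat. 1) = (\<top> :: ennreal)"
      using summable_suminf_not_top[of "\<lambda>_. 1"] by (auto simp: summable_const_iff)
    ultimately show ?thesis by simp
  qed
  then show ?thesis
    unfolding annealed_return_time_def by (simp add: nn_integral_suminf)
qed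

lemma measurable_return_mean[measurable (raw)]:
  assumes [measurable]: "f \<in> M \<rightarrow>\<^sub>M borel"
  shows "(\<lambda>z. return_mean r p (f z)) \<in> borel_measurable M"
  unfolding return_mean_eq_suminf by measurable

lemma return_mean_antimono: "r \<le> s \<Longrightarrow> return_mean s p x \<le> return_mean r p x"
  unfolding return_mean_eq_suminf
  by (intro suminf_le summableI emeasure_mono avoiding_antimono) auto

lemma return_mean_ge:
  assumes "emeasure P (avoiding r {p<..N} x) \<ge> c"
  shows "of_nat (Suc N) * c \<le> return_mean r p x"
proof -
  have "of_nat (Suc N) * c = (\<Sum>n\<le>N. c)" by simp
  also have "\<dots> \<le> (\<Sum>n\<le>N. emeasure P (avoiding r {p<..n} x))"
  proof (rule sum_mono)
    fix n assume "n \<in> {..N}"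
    then have "emeasure P (avoiding r {p<..N} x) \<le> emeasure P (avoiding r {p<..n} x)"
      by (intro emeasure_mono avoiding_antimono) auto
    with assms show "c \<le> emeasure P (avoiding r {p<..n} x)" by (rule order_trans)
  qed
  also have "\<dots> \<le> return_mean r p x"
    unfolding return_mean_eq_suminf by (rule sum_le_suminf) auto
  finally show ?thesis .
qed

text \<open>If \<open>x\<close> and \<open>orbit k \<omega> x\<close> are in a ball of radius \<open>r\<close>, they are closer than \<open>2 * r\<close>. Hence
  the return time to the moving centre \<open>x\<close> is at most the visit time of the skew product to a
  fixed cylinder, to which the Kac inequality applies.\<close>

lemma kac_ball: "(\<integral>\<^sup>+x\<in>ball z r. return_mean (2 * r) p x \<partial>\<mu>) \<le> of_nat (p + 1)"
proof -
  let ?S = "skew_product \<theta> T" and ?M = "P \<Otimes>\<^sub>M \<mu>"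
  define B where "B = {q \<in> space ?M. dist z (snd q) < r}"
  have [measurable]: "B \<in> sets ?M" unfolding B_def by measurable
  have "(\<integral>\<^sup>+x\<in>ball z r. return_mean (2 * r) p x \<partial>\<mu>)
      = (\<Sum>n. \<integral>\<^sup>+x. emeasure P (avoiding (2 * r) {p<..n} x) * indicator (ball z r) x \<partial>\<mu>)"
    unfolding return_mean_eq_suminf ennreal_suminf_multc[symmetric]
    by (intro nn_integral_suminf borel_measurable_times_ennreal measurable_prob_avoiding
        borel_measurable_indicator) auto
  also have "\<dots> \<le> (\<Sum>n. emeasure ?M {q\<in>space ?M. q \<in> B \<and> (\<forall>k\<in>{p<..n}. (?S ^^ k) q \<notin> B)})"
  proof (intro suminf_le summableI)
    fix n
    have [measurable]: "(?S ^^ k) \<in> ?M \<rightarrow>\<^sub>M ?M" for k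
      using skew_product_measurable by (rule measurable_compose_n)
    have E: "{q\<in>space ?M. q \<in> B \<and> (\<forall>k\<in>{p<..n}. (?S ^^ k) q \<notin> B)} \<in> sets ?M" (is "?E \<in> _")
      by measurable
    have "emeasure P (avoiding (2 * r) {p<..n} x) * indicator (ball z r) x
        \<le> emeasure P ((\<lambda>\<omega>. (\<omega>, x)) -` ?E)" for x
    proof (cases "x \<in> ball z r")
      case True
      have "(\<omega>, x) \<in> ?E" if \<omega>: "\<omega> \<in> avoiding (2 * r) {p<..n} x" for \<omega>
      proof -
        have "orbit k \<omega> x \<notin> ball z r" if "k \<in> {p<..n}" for k
        proof
          assume "orbit k \<omega> x \<in> ball z r"
          then have "dist (orbit k \<omega> x) x < 2 * r"
            using True dist_triangle3[of "orbit k \<omega> x" x z] by simp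
          moreover have "2 * r \<le> dist (orbit k \<omega> x) x"
          using \<omega> that unfolding avoiding_def by blast
        ultimately show False by simp
        qed
        with True show ?thesis by (auto simp: B_def space_pair_measure skew_product_iterate)
      qed
      then have "emeasure P (avoiding (2 * r) {p<..n} x) \<le> emeasure P ((\<lambda>\<omega>. (\<omega>, x)) -` ?E)"
        by (intro emeasure_mono sets_Pair2[OF E]) auto
      with True show ?thesis by simp
    qed simp
    then have "(\<integral>\<^sup>+x. emeasure P (avoiding (2 * r) {p<..n} x) * indicator (ball z r) x \<partial>\<mu>)
        \<le> (\<integral>\<^sup>+x. emeasure P ((\<lambda>\<omega>. (\<omega>, x)) -` ?E) \<partial>\<mu>)"
      by (rule nn_integral_mono)
    also have "\<dots> = emeasure ?M ?E"
      by (rule pair.emeasure_pair_measure_alt2[OF E, symmetric])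
    finally show "(\<integral>\<^sup>+x. emeasure P (avoiding (2 * r) {p<..n} x) * indicator (ball z r) x \<partial>\<mu>)
        \<le> emeasure ?M ?E" .
  qed
  also have "\<dots> \<le> of_nat (p + 1)"
  proof (rule iterated_kac_inequality)
    show "prob_space ?M" by (rule pair.prob_space_axioms)
    show "distr ?M ?M ?S = ?M" using stationary unfolding stationary_measure_def by blast
    show "B \<in> sets ?M" by fact
  qed (rule skew_product_measurable)
  finally show ?thesis .
qed

end

section \<open>Return times and ball masses at doubling scales\<close>

context stationary_rds
begin

abbreviation ball_mass :: "'x \<Rightarrow> real \<Rightarrow> real" where
  "ball_mass x r \<equiv> measure \<mu> (ball x r)"

lemma ball_mass_mono: "r \<le> s \<Longrightarrow> ball_mass x r \<le> ball_mass x s"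
  by (intro mu.finite_measure_mono) auto

lemma measurable_ball_mass[measurable]: "(\<lambda>x. ball_mass x r) \<in> borel_measurable borel"
proof -
  have "(\<lambda>x. emeasure \<mu> (Pair x -` {z \<in> space (borel \<Otimes>\<^sub>M \<mu>). dist (fst z) (snd z) < r}))
      \<in> borel_measurable borel"
    by (rule mu.measurable_emeasure_Pair) measurable
  then have "(\<lambda>x. emeasure \<mu> (ball x r)) \<in> borel_measurable borel"
    by (simp add: space_pair_measure vimage_def ball_def)
  then show ?thesis unfolding measure_def by measurable
qed

text \<open>The factor 8 leaves room for all balls that are compared below: balls of radius \<open>r\<close> at
  \<open>2 * r\<close>-separated centres are disjoint, those of radius \<open>2 * r\<close> cover, and those of radius
  \<open>4 * r\<close> contain the points that return.\<close>

definition doubling_at :: "nat \<Rightarrow> real \<Rightarrow> 'x set" where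
  "doubling_at C r = {x. ball_mass x (8 * r) \<le> real C * ball_mass x r}"

lemma doubling_at_measurable[measurable]: "doubling_at C r \<in> sets borel"
  unfolding doubling_at_def by measurable

lemma sum_ball_mass_separated:
  assumes "finite F" "separated (2 * r) F"
  shows "(\<Sum>z\<in>F. ball_mass z r) \<le> 1"
proof -
  have "(\<Sum>z\<in>F. ball_mass z r) = measure \<mu> (\<Union>z\<in>F. ball z r)"
    using assms disjoint_balls_separated
    by (intro mu.finite_measure_finite_Union[symmetric]) auto
  then show ?thesis by simp
qed

text \<open>Markov's inequality on each ball of a cover. On the ball of radius \<open>4 * r\<close> about a centre
  \<open>z\<close>, the return time has integral at most \<open>p + 1\<close>, so the exceptional points near \<open>z\<close> have mass
  at most \<open>(p + 1) / l\<close> times the mass of that ball; by doubling, the latter is comparable to the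
  mass of a ball that is disjoint from the others.\<close>

lemma emeasure_large_return_mean:
  assumes pack: "polynomial_packing K d (UNIV :: 'x set)" and r: "0 < r"
  shows "l * emeasure \<mu> {x \<in> doubling_at C r. l < return_mean (8 * r) p x * ball_mass x r}
           \<le> of_nat (C * (p + 1))"
proof -
  define D where "D = {x \<in> doubling_at C r. l < return_mean (8 * r) p x * ball_mass x r}"
  have D[measurable]: "D \<in> sets borel" unfolding D_def by measurable
  obtain F where F: "F \<subseteq> D" "finite F" "separated (2 * r) F" "D \<subseteq> (\<Union>z\<in>F. ball z (2 * r))"
    using polynomial_packing_maximal[OF pack, of "2 * r" D] r by auto
  have near: "l * emeasure \<mu> (D \<inter> ball z (2 * r)) \<le> of_nat (C * (p + 1)) * ennreal (ball_mass z r)"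
    if z: "z \<in> F" for z
  proof -
    have "l * emeasure \<mu> (D \<inter> ball z (2 * r)) = (\<integral>\<^sup>+x. l * indicator (D \<inter> ball z (2 * r)) x \<partial>\<mu>)"
      by (rule nn_integral_cmult_indicator[symmetric]) auto
    also have "\<dots> \<le> (\<integral>\<^sup>+x. ball_mass z (4 * r) *
        (return_mean (2 * (4 * r)) p x * indicator (ball z (4 * r)) x) \<partial>\<mu>)"
    proof (rule nn_integral_mono)
      fix x
      show "l * indicator (D \<inter> ball z (2 * r)) x \<le> ball_mass z (4 * r) *
          (return_mean (2 * (4 * r)) p x * indicator (ball z (4 * r)) x)"
      proof (cases "x \<in> D \<inter> ball z (2 * r)")
        case True
        then have "ball x r \<subseteq> ball z (4 * r)"
          using r by (auto simp: subset_eq) (smt (verit) dist_triangle)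
        then have "ball_mass x r \<le> ball_mass z (4 * r)"
          by (intro mu.finite_measure_mono) auto
        then have "return_mean (8 * r) p x * ball_mass x r \<le> return_mean (8 * r) p x * ball_mass z (4 * r)"
          by (intro mult_left_mono ennreal_leI) auto
        moreover have "l \<le> return_mean (8 * r) p x * ball_mass x r"
          using True by (simp add: D_def less_imp_le)
        ultimately have "l \<le> return_mean (8 * r) p x * ball_mass z (4 * r)"
          by (rule order_trans[rotated])
        moreover have "x \<in> ball z (4 * r)" using True r by auto
        ultimately show ?thesis using True by (simp add: mult.commute)
      qed simp
    qed
    also have "\<dots> = ball_mass z (4 * r) * (\<integral>\<^sup>+x\<in>ball z (4 * r). return_mean (2 * (4 * r)) p x \<partial>\<mu>)"
      by (intro nn_integral_cmult borel_measurable_times_ennreal measurable_return_mean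
          borel_measurable_indicator) auto
    also have "\<dots> \<le> ennreal (real C * ball_mass z r) * of_nat (p + 1)"
    proof (intro mult_mono kac_ball ennreal_leI)
      have "ball_mass z (4 * r) \<le> ball_mass z (8 * r)" using r by (intro ball_mass_mono) simp
      also have "\<dots> \<le> real C * ball_mass z r"
        using z F(1) by (auto simp: D_def doubling_at_def)
      finally show "ball_mass z (4 * r) \<le> real C * ball_mass z r" .
    qed auto
    also have "\<dots> = of_nat (C * (p + 1)) * ennreal (ball_mass z r)"
      by (simp add: ennreal_mult ennreal_of_nat_eq_real_of_nat[symmetric] algebra_simps)
    finally show ?thesis .
  qed
  have "emeasure \<mu> D \<le> emeasure \<mu> (\<Union>z\<in>F. D \<inter> ball z (2 * r))"
    using F(2,4) by (intro emeasure_mono) (auto intro!: sets.finite_UN)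
  also have "\<dots> \<le> (\<Sum>z\<in>F. emeasure \<mu> (D \<inter> ball z (2 * r)))"
    using F(2) by (intro emeasure_subadditive_finite) auto
  finally have "l * emeasure \<mu> D \<le> (\<Sum>z\<in>F. l * emeasure \<mu> (D \<inter> ball z (2 * r)))"
    by (simp add: sum_distrib_left[symmetric] mult_left_mono)
  also have "\<dots> \<le> (\<Sum>z\<in>F. of_nat (C * (p + 1)) * ennreal (ball_mass z r))"
    by (rule sum_mono) (rule near)
  also have "\<dots> = of_nat (C * (p + 1)) * ennreal (\<Sum>z\<in>F. ball_mass z r)"
    by (simp add: sum_distrib_left[symmetric] sum_ennreal)
  also have "\<dots> \<le> of_nat (C * (p + 1)) * 1"
    using sum_ball_mass_separated[OF F(2,3)] by (intro mult_left_mono) (auto simp: ennreal_le_1)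
  finally show ?thesis by (simp add: D_def)
qed

lemma AE_eventually_return_mean_le:
  assumes pack: "polynomial_packing K d (UNIV :: 'x set)" and \<eta>: "0 < \<eta>"
  shows "AE x in \<mu>. \<forall>\<^sub>F j in sequentially. x \<in> doubling_at C (2 powr - real j) \<longrightarrow>
           return_mean (8 * 2 powr - real j) p x * ball_mass x (2 powr - real j)
             \<le> ennreal (2 powr (\<eta> * real j))"
proof -
  define D where "D j = {x \<in> doubling_at C (2 powr - real j). ennreal (2 powr (\<eta> * real j))
      < return_mean (8 * 2 powr - real j) p x * ball_mass x (2 powr - real j)}" for j
  have D: "D j \<in> sets \<mu>" for j unfolding D_def by measurable
  have bound: "measure \<mu> (D j) \<le> real (C * (p + 1)) * (2 powr - \<eta>) ^ j" for j
  proof -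
    have "ennreal (2 powr (\<eta> * real j) * measure \<mu> (D j)) \<le> ennreal (real (C * (p + 1)))"
      using emeasure_large_return_mean[OF pack, of "2 powr - real j" "ennreal (2 powr (\<eta> * real j))" C p]
      by (simp add: D_def[symmetric] mu.emeasure_eq_measure ennreal_mult ennreal_of_nat_eq_real_of_nat
          del: of_nat_mult of_nat_add of_nat_Suc)
    then have "2 powr (\<eta> * real j) * measure \<mu> (D j) \<le> real (C * (p + 1))"
      by (subst (asm) ennreal_le_iff) auto
    then have "measure \<mu> (D j) \<le> real (C * (p + 1)) * 2 powr - (\<eta> * real j)"
      by (simp add: powr_minus field_simps del: of_nat_mult of_nat_add of_nat_Suc)
    also have "2 powr - (\<eta> * real j) = (2 powr - \<eta>) ^ j"
      by (simp add: powr_realpow[symmetric] powr_powr)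
    finally show ?thesis .
  qed
  have "2 powr - \<eta> < (1 :: real)" using powr_less_mono[of "- \<eta>" 0 "2 :: real"] \<eta> by simp
  then have "summable (\<lambda>j. measure \<mu> (D j))"
    by (intro summable_comparison_test'[OF summable_mult[OF summable_geometric], where N = 0])
       (use bound in auto)
  then have "AE x in \<mu>. \<forall>\<^sub>F j in sequentially. x \<in> space \<mu> - D j"
    by (intro borel_cantelli_AE1) (use D in \<open>auto simp: less_top[symmetric]\<close>)
  then show ?thesis
    by (rule AE_mp) (auto intro!: AE_I2 elim!: eventually_mono simp: D_def not_less)
qed

text \<open>A set of points all of whose \<open>r\<close>-balls have mass below \<open>r powr (d + 1)\<close> is covered by about
  \<open>r powr -d\<close> of these balls, so its mass is of order \<open>r\<close>, which is summable over dyadic radii.\<close>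

lemma AE_eventually_ball_mass_ge:
  assumes pack: "polynomial_packing K d (UNIV :: 'x set)"
  shows "AE x in \<mu>. \<forall>\<^sub>F j in sequentially. 2 powr - (real (d + 1) * real j) \<le> ball_mass x (2 powr - real j)"
proof -
  define D where "D j = {x. ball_mass x (2 powr - real j) < 2 powr - (real (d + 1) * real j)}" for j :: nat
  have D[measurable]: "D j \<in> sets borel" for j unfolding D_def by measurable
  have bound: "measure \<mu> (D j) \<le> K * (1 / 2) ^ j" for j
  proof -
    let ?r = "2 powr - real j :: real"
    have r: "0 < ?r" "?r \<le> 1" using powr_mono[of "- real j" 0 "2 :: real"] by auto
    obtain F where F: "F \<subseteq> D j" "finite F" "separated ?r F" "D j \<subseteq> (\<Union>z\<in>F. ball z ?r)"
      using polynomial_packing_maximal[OF pack r(1)] by metis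
    have "measure \<mu> (D j) \<le> measure \<mu> (\<Union>z\<in>F. ball z ?r)"
      using F by (intro mu.finite_measure_mono) auto
    also have "\<dots> \<le> (\<Sum>z\<in>F. ball_mass z ?r)"
      using F by (intro measure_UNION_le) auto
    also have "\<dots> \<le> (\<Sum>z\<in>F. 2 powr - (real (d + 1) * real j))"
      using F(1) by (intro sum_mono) (auto simp: D_def)
    also have "\<dots> = real (card F) * 2 powr - (real (d + 1) * real j)" by simp
    also have "\<dots> \<le> K * (1 / ?r) ^ d * 2 powr - (real (d + 1) * real j)"
      using polynomial_packingD[OF pack r subset_UNIV F(3)] by (intro mult_right_mono) auto
    also have "(1 / ?r) ^ d = 2 powr (real d * real j)"
      by (simp add: powr_minus field_simps powr_realpow[symmetric] powr_powr)
    also have "K * 2 powr (real d * real j) * 2 powr - (real (d + 1) * real j) = K * 2 powr - real j"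
      by (simp add: mult.assoc powr_add[symmetric] algebra_simps)
    also have "2 powr - real j = (1 / 2 :: real) ^ j"
      by (simp add: powr_minus powr_realpow power_divide divide_simps)
    finally show ?thesis .
  qed
  have "summable (\<lambda>j. measure \<mu> (D j))"
    by (intro summable_comparison_test'[OF summable_mult[OF summable_geometric[of "1 / 2 :: real"]], where N = 0])
       (use bound in auto)
  then have "AE x in \<mu>. \<forall>\<^sub>F j in sequentially. x \<in> space \<mu> - D j"
    by (intro borel_cantelli_AE1) (auto simp: less_top[symmetric])
  then show ?thesis
    by (rule AE_mp) (auto intro!: AE_I2 elim!: eventually_mono simp: D_def not_less)
qed

end

section \<open>Rare returns from decay of correlations\<close>

text \<open>A Lipschitz function between the indicators of the balls of radius \<open>4 * r\<close> and \<open>8 * r\<close>.\<close>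

definition cutoff :: "'a::metric_space \<Rightarrow> real \<Rightarrow> 'a \<Rightarrow> real" where
  "cutoff z r y = max 0 (min 1 (2 - dist z y / (4 * r)))"

lemma cutoff_bounds: "0 \<le> cutoff z r y" "cutoff z r y \<le> 1"
  by (auto simp: cutoff_def)

lemma cutoff_eq_1: "0 < r \<Longrightarrow> dist z y \<le> 4 * r \<Longrightarrow> cutoff z r y = 1"
  by (simp add: cutoff_def field_simps)

lemma cutoff_le_indicator: "0 < r \<Longrightarrow> cutoff z r y \<le> indicator (ball z (8 * r)) y"
  by (auto simp: cutoff_def indicator_def field_simps)

lemma cutoff_lipschitz:
  assumes "0 < r"
  shows "(1 / (4 * r))-lipschitz_on UNIV (cutoff z r)"
proof (rule lipschitz_onI)
  fix x y
  have "dist (cutoff z r x) (cutoff z r y) \<le> \<bar>dist z x / (4 * r) - dist z y / (4 * r)\<bar>"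
    by (simp add: cutoff_def dist_real_def)
  also have "\<dots> = \<bar>dist z x - dist z y\<bar> / (4 * r)"
    using assms by (simp add: diff_divide_distrib[symmetric])
  also have "\<dots> \<le> dist x y / (4 * r)"
    using assms abs_dist_diff_le[of x z y] by (intro divide_right_mono) (auto simp: dist_commute)
  finally show "dist (cutoff z r x) (cutoff z r y) \<le> 1 / (4 * r) * dist x y" by simp
qed (use assms in simp)

lemma lipschitz_norm_cutoff:
  assumes "0 < r" "r \<le> 1"
  shows "0 \<le> lipschitz_norm (cutoff z r)" "lipschitz_norm (cutoff z r) \<le> 2 / r"
proof -
  let ?f = "cutoff z r" and ?L = "{L. L-lipschitz_on UNIV (cutoff z r)}"
  have L0: "0 \<le> L" if "L \<in> ?L" for L using that lipschitz_on_nonneg by blast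
  have mem: "1 / (4 * r) \<in> ?L" using cutoff_lipschitz[OF assms(1)] by simp
  have "Inf ?L \<le> 1 / (4 * r)"
    using mem L0 by (intro cInf_lower) (auto intro!: bdd_belowI[of _ 0])
  also have "\<dots> \<le> 1 / r" using assms by (simp add: field_simps)
  finally have 1: "Inf ?L \<le> 1 / r" .
  have 2: "0 \<le> Inf ?L" using mem L0 by (intro cInf_greatest) auto
  have 3: "(SUP x. \<bar>?f x\<bar>) \<le> 1" using cutoff_bounds[of z r] by (intro cSUP_least) auto
  have "\<bar>?f z\<bar> \<le> (SUP x. \<bar>?f x\<bar>)"
    using cutoff_bounds[of z r] by (intro cSUP_upper) (auto intro!: bdd_aboveI[of _ 1])
  then have 4: "0 \<le> (SUP x. \<bar>?f x\<bar>)" by (meson abs_ge_zero order_trans)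
  have "1 \<le> 1 / r" using assms by simp
  with 1 3 show "lipschitz_norm (cutoff z r) \<le> 2 / r"
    unfolding lipschitz_norm_def by (simp add: add_divide_distrib[symmetric])
  show "0 \<le> lipschitz_norm (cutoff z r)" using 2 4 unfolding lipschitz_norm_def by simp
qed

lemma cutoff_measurable[measurable]: "cutoff z r \<in> borel_measurable borel"
  unfolding cutoff_def divide_inverse
  by (intro borel_measurable_continuous_onI continuous_intros)

text \<open>Times between the powers \<open>-\<eta>\<close> and \<open>-(a - \<eta>)\<close> of the radius \<open>2 powr -j\<close>. The lower limit is
  where the decay of correlations beats every loss that is polynomial in the radius; the upper
  limit keeps the number of times below the inverse of a ball mass \<open>2 powr -(a * j)\<close> by the factor
  \<open>2 powr -(\<eta> * j)\<close>.\<close>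

definition return_window :: "real \<Rightarrow> real \<Rightarrow> nat \<Rightarrow> nat set" where
  "return_window a \<eta> j =
     {k. 2 powr (\<eta> * real j) \<le> real k \<and> real k \<le> 2 powr ((a - \<eta>) * real j)}"

lemma return_window_finite: "finite (return_window a \<eta> j)"
  and return_window_card: "real (card (return_window a \<eta> j)) \<le> 2 powr ((a - \<eta>) * real j)"
  and return_window_pos: "k \<in> return_window a \<eta> j \<Longrightarrow> 1 \<le> k"
proof -
  show pos: "1 \<le> k" if "k \<in> return_window a \<eta> j" for k
  proof -
    have "0 < (2 :: real) powr (\<eta> * real j)" by simp
    also have "\<dots> \<le> real k" using that by (simp add: return_window_def)
    finally show ?thesis by simp
  qed
  let ?N = "nat \<lfloor>2 powr ((a - \<eta>) * real j) :: real\<rfloor>"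
  have sub: "return_window a \<eta> j \<subseteq> {1..?N}"
    using pos by (auto simp: return_window_def le_nat_floor)
  then show "finite (return_window a \<eta> j)" by (rule finite_subset) simp
  have "card (return_window a \<eta> j) \<le> ?N"
    using card_mono[OF _ sub] by simp
  then have "real (card (return_window a \<eta> j)) \<le> real ?N" by (rule of_nat_mono)
  also have "\<dots> \<le> 2 powr ((a - \<eta>) * real j)" by (simp add: of_nat_floor)
  finally show "real (card (return_window a \<eta> j)) \<le> 2 powr ((a - \<eta>) * real j)" .
qed

context stationary_rds
begin

definition correlation_bound :: "(nat \<Rightarrow> real) \<Rightarrow> bool" where
  "correlation_bound \<rho> \<longleftrightarrow>
     (\<forall>n\<ge>1. \<forall>\<psi> \<phi>. lipschitz_function \<psi> \<longrightarrow> lipschitz_function \<phi> \<longrightarrow>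
        \<bar>(\<integral>x. (\<integral>\<omega>. \<psi> (orbit n \<omega> x) * \<phi> x \<partial>P) \<partial>\<mu>) - (\<integral>x. \<psi> x \<partial>\<mu>) * (\<integral>x. \<phi> x \<partial>\<mu>)\<bar>
          \<le> lipschitz_norm \<psi> * lipschitz_norm \<phi> * \<rho> n)"

lemma compl_avoiding_measurable[measurable]: "- avoiding r I x \<in> sets P"
  using sets.compl_sets[OF avoiding_measurable] by (simp add: Compl_eq_Diff_UNIV)

lemma emeasure_compl_avoiding:
  "emeasure P (- avoiding r I x) = 1 - emeasure P (avoiding r I x)"
  using emeasure_compl[of "avoiding r I x" P] by (simp add: Compl_eq_Diff_UNIV emeasure_space_1[simplified])

lemma measurable_prob_compl_avoiding[measurable (raw)]:
  assumes [measurable]: "f \<in> M \<rightarrow>\<^sub>M borel"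
  shows "(\<lambda>z. emeasure P (- avoiding r I (f z))) \<in> borel_measurable M"
  unfolding emeasure_compl_avoiding by measurable

text \<open>A point of the ball of radius \<open>2 * r\<close> that returns within \<open>r\<close> is in the ball of radius
  \<open>4 * r\<close> at both times. So the cutoff function \<open>h\<close> bounds the left side by the correlation of \<open>h\<close>
  with itself, which is nearly the square of its integral.\<close>

lemma return_near_center:
  assumes corr: "correlation_bound \<rho>" and n: "1 \<le> n" and r: "0 < r" "r \<le> 1"
  shows "(\<integral>\<^sup>+x\<in>ball z (2 * r). emeasure P (- avoiding r {n} x) \<partial>\<mu>)
           \<le> ennreal ((ball_mass z (8 * r))\<^sup>2 + 4 / r\<^sup>2 * \<bar>\<rho> n\<bar>)"
proof -
  define h where "h = cutoff z r"
  have h01: "0 \<le> h y" "h y \<le> 1" for y using cutoff_bounds[of z r y] by (auto simp: h_def)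
  have [measurable]: "h \<in> borel_measurable borel" by (simp add: h_def)
  have [measurable]: "h \<in> borel_measurable \<mu>" by (simp add: measurable_def[of \<mu>] cong: measurable_cong_sets)
  have lip: "lipschitz_function h"
    unfolding lipschitz_function_def h_def using cutoff_lipschitz[OF r(1)] by blast
  have hh: "0 \<le> h a * h b" "h a * h b \<le> 1" for a b using h01 by (auto intro: mult_le_one)
  have meas[measurable]: "(\<lambda>\<omega>. h (orbit n \<omega> x) * h x) \<in> borel_measurable P" for x
    by measurable
  have int1: "integrable P (\<lambda>\<omega>. h (orbit n \<omega> x) * h x)" for x
    by (rule integrable_const_bound[of _ 1]) (use hh in auto)
  define c where "c x = (\<integral>\<omega>. h (orbit n \<omega> x) * h x \<partial>P)" for x
  have c01: "0 \<le> c x" "c x \<le> 1" for x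
  proof -
    show "0 \<le> c x" unfolding c_def by (rule Bochner_Integration.integral_nonneg) (rule hh)
    show "c x \<le> 1" unfolding c_def by (rule integral_le_const[OF int1]) (intro AE_I2 hh)
  qed
  have cmeas: "c \<in> borel_measurable \<mu>"
    unfolding c_def by (intro borel_measurable_lebesgue_integral) measurable
  have int2: "integrable \<mu> c"
    by (rule mu.integrable_const_bound[of _ 1]) (use c01 cmeas in auto)
  have "(\<integral>\<^sup>+x\<in>ball z (2 * r). emeasure P (- avoiding r {n} x) \<partial>\<mu>) \<le> (\<integral>\<^sup>+x. ennreal (c x) \<partial>\<mu>)"
  proof (rule nn_integral_mono)
    fix x
    show "emeasure P (- avoiding r {n} x) * indicator (ball z (2 * r)) x \<le> ennreal (c x)"
    proof (cases "x \<in> ball z (2 * r)")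
      case True
      have "emeasure P (- avoiding r {n} x) = (\<integral>\<^sup>+\<omega>. indicator (- avoiding r {n} x) \<omega> \<partial>P)"
        by simp
      also have "\<dots> \<le> (\<integral>\<^sup>+\<omega>. ennreal (h (orbit n \<omega> x) * h x) \<partial>P)"
      proof (rule nn_integral_mono)
        fix \<omega>
        show "indicator (- avoiding r {n} x) \<omega> \<le> ennreal (h (orbit n \<omega> x) * h x)"
        proof (cases "dist (orbit n \<omega> x) x < r")
          case close: True
          have "dist z (orbit n \<omega> x) \<le> 4 * r"
            using dist_triangle2[of z "orbit n \<omega> x" x] close True r by (simp add: dist_commute)
          moreover have "dist z x \<le> 4 * r" using True r by simp
          ultimately have "h (orbit n \<omega> x) = 1" "h x = 1"
            using r by (simp_all add: h_def cutoff_eq_1)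
          then show ?thesis by (simp add: indicator_def)
        qed (simp add: avoiding_def)
      qed
      also have "\<dots> = ennreal (c x)"
        unfolding c_def using hh by (intro nn_integral_eq_integral int1) auto
      finally show ?thesis using True by simp
    qed simp
  qed
  also have "\<dots> = ennreal (\<integral>x. c x \<partial>\<mu>)"
    using c01 by (intro nn_integral_eq_integral int2) auto
  also have "\<dots> \<le> ennreal ((ball_mass z (8 * r))\<^sup>2 + 4 / r\<^sup>2 * \<bar>\<rho> n\<bar>)"
  proof (rule ennreal_leI)
    have inth: "integrable \<mu> h"
      by (rule mu.integrable_const_bound[of _ 1]) (use h01 in auto)
    have "(\<integral>x. h x \<partial>\<mu>) \<le> (\<integral>x. indicator (ball z (8 * r)) x \<partial>\<mu>)"
      using cutoff_le_indicator[OF r(1)]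
      by (intro integral_mono inth) (auto simp: h_def less_top[symmetric] intro!: integrable_real_indicator)
    then have hm: "(\<integral>x. h x \<partial>\<mu>) \<le> ball_mass z (8 * r)" by simp
    have h0: "0 \<le> (\<integral>x. h x \<partial>\<mu>)" by (intro Bochner_Integration.integral_nonneg h01)
    have "(\<integral>x. c x \<partial>\<mu>) \<le> (\<integral>x. h x \<partial>\<mu>) * (\<integral>x. h x \<partial>\<mu>) + lipschitz_norm h * lipschitz_norm h * \<rho> n"
    proof -
      have "\<bar>(\<integral>x. c x \<partial>\<mu>) - (\<integral>x. h x \<partial>\<mu>) * (\<integral>x. h x \<partial>\<mu>)\<bar> \<le> lipschitz_norm h * lipschitz_norm h * \<rho> n"
        using corr n lip unfolding correlation_bound_def c_def by blast
      then show ?thesis by (simp add: abs_le_iff)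
    qed
    also have "\<dots> \<le> (ball_mass z (8 * r))\<^sup>2 + 4 / r\<^sup>2 * \<bar>\<rho> n\<bar>"
    proof (rule add_mono)
      show "(\<integral>x. h x \<partial>\<mu>) * (\<integral>x. h x \<partial>\<mu>) \<le> (ball_mass z (8 * r))\<^sup>2"
        unfolding power2_eq_square using hm h0 by (intro mult_mono) auto
      have "lipschitz_norm h * lipschitz_norm h \<le> 2 / r * (2 / r)"
        unfolding h_def using lipschitz_norm_cutoff[OF r] r by (intro mult_mono) auto
      then have "lipschitz_norm h * lipschitz_norm h * \<bar>\<rho> n\<bar> \<le> 2 / r * (2 / r) * \<bar>\<rho> n\<bar>"
        by (rule mult_right_mono) simp
      moreover have "lipschitz_norm h * lipschitz_norm h * \<rho> n \<le> lipschitz_norm h * lipschitz_norm h * \<bar>\<rho> n\<bar>"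
        by (intro mult_left_mono) auto
      ultimately show "lipschitz_norm h * lipschitz_norm h * \<rho> n \<le> 4 / r\<^sup>2 * \<bar>\<rho> n\<bar>"
        by (simp add: power2_eq_square)
    qed
    finally show "(\<integral>x. c x \<partial>\<mu>) \<le> (ball_mass z (8 * r))\<^sup>2 + 4 / r\<^sup>2 * \<bar>\<rho> n\<bar>" .
  qed
  finally show ?thesis .
qed

definition thin_doubling :: "nat \<Rightarrow> real \<Rightarrow> real \<Rightarrow> 'x set" where
  "thin_doubling C v r = {x \<in> doubling_at C r. ball_mass x (8 * r) \<le> v}"

lemma thin_doubling_measurable[measurable]: "thin_doubling C v r \<in> sets borel"
  unfolding thin_doubling_def by measurable

text \<open>Of the squared mass of each ball, one factor is at most \<open>v\<close> and the other is comparable, by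
  doubling, to the mass of a ball that is disjoint from the others. The errors of decorrelation
  add up to their bound times the number of balls.\<close>

lemma return_from_thin_doubling:
  assumes pack: "polynomial_packing K d (UNIV :: 'x set)" and corr: "correlation_bound \<rho>"
    and n: "1 \<le> n" and r: "0 < r" "r \<le> 1" and v: "0 \<le> v"
  shows "(\<integral>\<^sup>+x\<in>thin_doubling C v r. emeasure P (- avoiding r {n} x) \<partial>\<mu>)
           \<le> ennreal (real C * v + K * (1 / r) ^ d * (4 / r\<^sup>2 * \<bar>\<rho> n\<bar>))"
proof -
  let ?H = "thin_doubling C v r" and ?e = "\<lambda>x. emeasure P (- avoiding r {n} x)"
  obtain F where F: "F \<subseteq> ?H" "finite F" "separated (2 * r) F" "?H \<subseteq> (\<Union>z\<in>F. ball z (2 * r))"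
    using polynomial_packing_maximal[OF pack, of "2 * r" ?H] r by auto
  have "separated r F" using separated_mono[OF F(3)] r by simp
  then have card: "real (card F) \<le> K * (1 / r) ^ d"
    using polynomial_packingD[OF pack r subset_UNIV] by blast
  have "(\<integral>\<^sup>+x\<in>?H. ?e x \<partial>\<mu>) \<le> (\<integral>\<^sup>+x. (\<Sum>z\<in>F. ?e x * indicator (ball z (2 * r)) x) \<partial>\<mu>)"
  proof (rule nn_integral_mono)
    fix x
    show "?e x * indicator ?H x \<le> (\<Sum>z\<in>F. ?e x * indicator (ball z (2 * r)) x)"
    proof (cases "x \<in> ?H")
      case True
      then obtain z where z: "z \<in> F" "x \<in> ball z (2 * r)" using F(4) by blast
      have "?e x * indicator ?H x = ?e x * indicator (ball z (2 * r)) x"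
        using True z(2) by simp
      also have "\<dots> \<le> (\<Sum>z\<in>F. ?e x * indicator (ball z (2 * r)) x)"
        by (rule member_le_sum) (use z F(2) in auto)
      finally show ?thesis .
    qed simp
  qed
  also have "\<dots> = (\<Sum>z\<in>F. \<integral>\<^sup>+x\<in>ball z (2 * r). ?e x \<partial>\<mu>)"
    by (intro nn_integral_sum borel_measurable_times_ennreal measurable_prob_compl_avoiding
        borel_measurable_indicator) auto
  also have "\<dots> \<le> (\<Sum>z\<in>F. ennreal ((ball_mass z (8 * r))\<^sup>2 + 4 / r\<^sup>2 * \<bar>\<rho> n\<bar>))"
    by (intro sum_mono return_near_center corr n r)
  also have "\<dots> = ennreal (\<Sum>z\<in>F. (ball_mass z (8 * r))\<^sup>2 + 4 / r\<^sup>2 * \<bar>\<rho> n\<bar>)"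
    by (intro sum_ennreal) auto
  also have "\<dots> \<le> ennreal (real C * v + K * (1 / r) ^ d * (4 / r\<^sup>2 * \<bar>\<rho> n\<bar>))"
  proof (rule ennreal_leI)
    have "(\<Sum>z\<in>F. (ball_mass z (8 * r))\<^sup>2) \<le> (\<Sum>z\<in>F. real C * v * ball_mass z r)"
    proof (rule sum_mono)
      fix z assume "z \<in> F"
      then have "ball_mass z (8 * r) \<le> v" "ball_mass z (8 * r) \<le> real C * ball_mass z r"
        using F(1) by (auto simp: thin_doubling_def doubling_at_def)
      then have "ball_mass z (8 * r) * ball_mass z (8 * r) \<le> v * (real C * ball_mass z r)"
        using v by (intro mult_mono) auto
      then show "(ball_mass z (8 * r))\<^sup>2 \<le> real C * v * ball_mass z r"
        by (simp add: power2_eq_square mult_ac)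
    qed
    also have "\<dots> = real C * v * (\<Sum>z\<in>F. ball_mass z r)"
      by (simp add: sum_distrib_left)
    also have "\<dots> \<le> real C * v * 1"
      using sum_ball_mass_separated[OF F(2,3)] v by (intro mult_left_mono) auto
    finally have "(\<Sum>z\<in>F. (ball_mass z (8 * r))\<^sup>2) \<le> real C * v" by simp
    moreover have "real (card F) * (4 / r\<^sup>2 * \<bar>\<rho> n\<bar>) \<le> K * (1 / r) ^ d * (4 / r\<^sup>2 * \<bar>\<rho> n\<bar>)"
      using card by (rule mult_right_mono) simp
    ultimately show "(\<Sum>z\<in>F. (ball_mass z (8 * r))\<^sup>2 + 4 / r\<^sup>2 * \<bar>\<rho> n\<bar>)
        \<le> real C * v + K * (1 / r) ^ d * (4 / r\<^sup>2 * \<bar>\<rho> n\<bar>)"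
      by (simp add: sum.distrib)
  qed
  finally show ?thesis .
qed

text \<open>The window has at most \<open>2 powr ((a - \<eta>) * j)\<close> times, and at each of them a return from a
  thin doubling scale has probability of order \<open>2 powr -(a * j)\<close>. The union bound leaves
  \<open>2 powr -(\<eta> * j)\<close>, which is summable.\<close>

lemma AE_summable_window_returns:
  assumes pack: "polynomial_packing K d (UNIV :: 'x set)" and corr: "correlation_bound \<rho>"
    and fast: "\<And>q. 0 < q \<Longrightarrow> (\<lambda>n. \<rho> n * real n powr q) \<longlonglongrightarrow> 0"
    and a: "0 < a" and \<eta>: "0 < \<eta>"
  shows "AE x in \<mu>. (\<Sum>j. emeasure P (- avoiding (2 powr - real j) (return_window a \<eta> j) x)
           * indicator (thin_doubling C (2 powr - (a * real j)) (2 powr - real j)) x) \<noteq> \<top>"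
proof -
  \<comment> \<open>From time \<open>2 powr (\<eta> * j)\<close> on, decay of order \<open>q\<close> yields the factor \<open>2 powr -((a + d + 2) * j)\<close>: \<open>d\<close> for
    the number of balls, 2 for the Lipschitz norms, \<open>a\<close> to match the mass of a ball.\<close>
  define q where "q = (a + real d + 2) / \<eta>"
  have q: "0 < q" "\<eta> * q = a + real d + 2" using a \<eta> by (auto simp: q_def)
  have "Bseq (\<lambda>n. \<rho> n * real n powr q)"
    using fast[OF q(1)] by (intro convergent_imp_Bseq convergentI)
  then obtain c where c: "0 < c" "\<And>n. \<bar>\<rho> n * real n powr q\<bar> \<le> c"
    unfolding Bseq_def by auto
  have K: "0 \<le> K"
    using polynomial_packingD[OF pack, of 1 "{}"] by (simp add: separated_def)
  define e where "e j x = emeasure P (- avoiding (2 powr - real j) (return_window a \<eta> j) x)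
      * indicator (thin_doubling C (2 powr - (a * real j)) (2 powr - real j)) x" for j :: nat and x
  have emeas: "e j \<in> borel_measurable \<mu>" for j
    unfolding e_def by (intro borel_measurable_times_ennreal measurable_prob_compl_avoiding
        borel_measurable_indicator) auto
  have bound: "(\<integral>\<^sup>+x. e j x \<partial>\<mu>) \<le> ennreal ((real C + 4 * K * c) * (2 powr - \<eta>) ^ j)" for j
  proof -
    define r where "r = (2 :: real) powr - real j"
    define W where "W = return_window a \<eta> j"
    define H where "H = thin_doubling C (2 powr - (a * real j)) r"
    have r: "0 < r" "r \<le> 1" using powr_mono[of "- real j" 0 "2 :: real"] by (auto simp: r_def)
    have term_le: "(\<integral>\<^sup>+x\<in>H. emeasure P (- avoiding r {n} x) \<partial>\<mu>)
        \<le> ennreal ((real C + 4 * K * c) * 2 powr - (a * real j))" if n: "n \<in> W" for n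
    proof -
      have n1: "1 \<le> n" using n return_window_pos by (simp add: W_def)
      define X where "X = (a + real d + 2) * real j"
      have "2 powr X = (2 powr (\<eta> * real j)) powr q"
        by (simp add: X_def powr_powr q(2)[symmetric] mult_ac)
      also have "\<dots> \<le> real n powr q"
        using n q(1) by (intro powr_mono2) (auto simp: W_def return_window_def)
      finally have "\<bar>\<rho> n\<bar> * 2 powr X \<le> \<bar>\<rho> n\<bar> * real n powr q"
        by (rule mult_left_mono) simp
      also have "\<dots> \<le> c" using c(2)[of n] by (simp add: abs_mult)
      finally have \<rho>: "\<bar>\<rho> n\<bar> \<le> c * 2 powr - X"
        by (simp add: powr_minus field_simps)
      have pw: "(1 / r) ^ d * (1 / r\<^sup>2) = 2 powr ((real d + 2) * real j)"
      proof -
        have "1 / r = 2 powr real j" by (simp add: r_def powr_minus field_simps)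
        then have "(1 / r) ^ d * (1 / r\<^sup>2) = (2 powr real j) ^ d * (2 powr real j)\<^sup>2"
          by (metis power_one_over)
        also have "\<dots> = 2 powr ((real d + 2) * real j)"
          by (simp add: powr_power powr_add[symmetric] algebra_simps)
        finally show ?thesis .
      qed
      have "K * (1 / r) ^ d * (4 / r\<^sup>2 * \<bar>\<rho> n\<bar>) = 4 * K * ((1 / r) ^ d * (1 / r\<^sup>2)) * \<bar>\<rho> n\<bar>"
        by simp
      also have "\<dots> \<le> 4 * K * 2 powr ((real d + 2) * real j) * (c * 2 powr - X)"
        unfolding pw using \<rho> K by (intro mult_left_mono) auto
      also have "\<dots> = 4 * K * c * (2 powr ((real d + 2) * real j) * 2 powr - X)"
        by simp
      also have "2 powr ((real d + 2) * real j) * 2 powr - X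
          = (2 powr - (a * real j) :: real)"
        unfolding powr_add[symmetric] by (simp add: X_def algebra_simps)
      finally have "real C * 2 powr - (a * real j) + K * (1 / r) ^ d * (4 / r\<^sup>2 * \<bar>\<rho> n\<bar>)
          \<le> (real C + 4 * K * c) * 2 powr - (a * real j)"
        by (simp add: distrib_right)
      moreover have "(\<integral>\<^sup>+x\<in>H. emeasure P (- avoiding r {n} x) \<partial>\<mu>)
          \<le> ennreal (real C * 2 powr - (a * real j) + K * (1 / r) ^ d * (4 / r\<^sup>2 * \<bar>\<rho> n\<bar>))"
        unfolding H_def by (rule return_from_thin_doubling[OF pack corr n1 r]) simp
      ultimately show ?thesis by (meson ennreal_leI order_trans)
    qed
    have "(\<integral>\<^sup>+x. e j x \<partial>\<mu>) \<le> (\<integral>\<^sup>+x. (\<Sum>n\<in>W. emeasure P (- avoiding r {n} x) * indicator H x) \<partial>\<mu>)"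
    proof (rule nn_integral_mono)
      fix x
      have "- avoiding r W x = (\<Union>n\<in>W. - avoiding r {n} x)"
        by (auto simp: avoiding_def)
      then have "emeasure P (- avoiding r W x) \<le> (\<Sum>n\<in>W. emeasure P (- avoiding r {n} x))"
        by (auto simp: W_def return_window_finite intro!: emeasure_subadditive_finite)
      then show "e j x \<le> (\<Sum>n\<in>W. emeasure P (- avoiding r {n} x) * indicator H x)"
        by (simp add: e_def r_def[symmetric] W_def[symmetric] H_def[symmetric]
            sum_distrib_right[symmetric] mult_right_mono)
    qed
    also have "\<dots> = (\<Sum>n\<in>W. \<integral>\<^sup>+x\<in>H. emeasure P (- avoiding r {n} x) \<partial>\<mu>)"
      by (intro nn_integral_sum borel_measurable_times_ennreal measurable_prob_compl_avoiding
          borel_measurable_indicator) (auto simp: H_def)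
    also have "\<dots> \<le> (\<Sum>n\<in>W. ennreal ((real C + 4 * K * c) * 2 powr - (a * real j)))"
      by (rule sum_mono) (rule term_le)
    also have "\<dots> = ennreal (real (card W) * ((real C + 4 * K * c) * 2 powr - (a * real j)))"
      using K c(1) by (subst sum_ennreal) auto
    also have "\<dots> \<le> ennreal ((real C + 4 * K * c) * (2 powr - \<eta>) ^ j)"
    proof (rule ennreal_leI)
      have "real (card W) * ((real C + 4 * K * c) * 2 powr - (a * real j))
          \<le> 2 powr ((a - \<eta>) * real j) * ((real C + 4 * K * c) * 2 powr - (a * real j))"
        using return_window_card K c(1) by (intro mult_right_mono) (auto simp: W_def)
      also have "\<dots> = (real C + 4 * K * c) * (2 powr ((a - \<eta>) * real j) * 2 powr - (a * real j))"
        by simp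
      also have "2 powr ((a - \<eta>) * real j) * 2 powr - (a * real j) = (2 powr - \<eta> :: real) ^ j"
        unfolding powr_add[symmetric] by (simp add: powr_power algebra_simps)
      finally show "real (card W) * ((real C + 4 * K * c) * 2 powr - (a * real j))
          \<le> (real C + 4 * K * c) * (2 powr - \<eta>) ^ j" .
    qed
    finally show ?thesis .
  qed
  have "2 powr - \<eta> < (1 :: real)" using powr_less_mono[of "- \<eta>" 0 "2 :: real"] \<eta> by simp
  then have sm: "summable (\<lambda>j. (real C + 4 * K * c) * (2 powr - \<eta>) ^ j)"
    by (intro summable_mult summable_geometric) simp
  have "(\<integral>\<^sup>+x. (\<Sum>j. e j x) \<partial>\<mu>) = (\<Sum>j. \<integral>\<^sup>+x. e j x \<partial>\<mu>)"
    using emeas by (rule nn_integral_suminf)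
  also have "\<dots> \<le> (\<Sum>j. ennreal ((real C + 4 * K * c) * (2 powr - \<eta>) ^ j))"
    by (intro suminf_le summableI bound)
  also have "\<dots> < \<top>"
    unfolding less_top[symmetric]
  proof (rule ennreal_suminf_neq_top[OF sm])
    fix j
    have "0 \<le> real C + 4 * K * c" using K c(1) by simp
    then show "0 \<le> (real C + 4 * K * c) * (2 powr - \<eta>) ^ j" by (rule mult_nonneg_nonneg) simp
  qed
  finally have fin: "(\<integral>\<^sup>+x. (\<Sum>j. e j x) \<partial>\<mu>) \<noteq> \<infinity>" by simp
  have "(\<lambda>x. \<Sum>j. e j x) \<in> borel_measurable \<mu>"
    using emeas by measurable
  from nn_integral_noteq_infinite[OF this fin] show ?thesis by (simp add: e_def)
qed

end

section \<open>Regular points and the upper estimate\<close>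

text \<open>Liminf and limsup of exponents may thus be computed at the radii \<open>r powr s\<close>.\<close>

lemma eventually_at_right_powr_iff:
  assumes "0 < s"
  shows "(\<forall>\<^sub>F r in at_right 0. Q (r powr s)) \<longleftrightarrow> (\<forall>\<^sub>F r in at_right (0 :: real). Q r)"
proof -
  have lim: "filterlim (\<lambda>r. r powr t) (at_right 0) (at_right (0 :: real))" if "0 < t" for t :: real
  proof -
    have "((\<lambda>r. r powr t) \<longlongrightarrow> 0 powr t) (at_right (0 :: real))"
      using that by (intro tendsto_powr' tendsto_intros)
        (auto intro!: eventually_mono[OF eventually_at_right_less])
    then show ?thesis
      using that by (auto simp: filterlim_at eventually_at_right_less intro!: eventually_mono[OF eventually_at_right_less])
  qed
  have inverse: "\<forall>\<^sub>F r in at_right (0 :: real). (r powr (1 / s)) powr s = r"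
    using eventually_at_right_less[of "0 :: real"] by eventually_elim (use assms in \<open>simp add: powr_powr\<close>)
  show ?thesis
  proof
    assume "\<forall>\<^sub>F r in at_right 0. Q (r powr s)"
    then have "\<forall>\<^sub>F r in at_right 0. Q ((r powr (1 / s)) powr s)"
      using lim[of "1 / s"] assms by (auto simp: filterlim_iff)
    with inverse show "\<forall>\<^sub>F r in at_right 0. Q r" by eventually_elim simp
  next
    assume "\<forall>\<^sub>F r in at_right 0. Q r"
    then show "\<forall>\<^sub>F r in at_right 0. Q (r powr s)"
      using lim[OF assms] by (auto simp: filterlim_iff)
  qed
qed

lemma eventually_at_right_dyadic:
  assumes "\<And>L. L0 \<le> L \<Longrightarrow> Q (2 powr - L)"
  shows "\<forall>\<^sub>F r in at_right (0 :: real). Q r"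
proof -
  have "\<forall>\<^sub>F r in at_right (0 :: real). r \<in> {0<..<2 powr - L0}"
    by (rule eventually_at_right_real) simp
  then show ?thesis
  proof eventually_elim
    case (elim r)
    then have "r = 2 powr - (- log 2 r)" by simp
    moreover have "L0 \<le> - log 2 r"
      using elim by (smt (verit) greaterThanLessThan_iff log_le_cancel_iff log_powr_cancel powr_gt_zero)
    ultimately show ?case using assms by metis
  qed
qed

lemma ennreal_le_if_mult_le:
  assumes "t * ennreal c \<le> ennreal b" "0 < c"
  shows "t \<le> ennreal (b / c)"
proof (cases t)
  case (real u)
  show ?thesis
  proof (cases "u = 0")
    case False
    then have "0 < u * c" using real assms(2) by simp
    moreover have "ennreal (u * c) \<le> ennreal b"
      using assms real by (simp add: ennreal_mult)
    ultimately have "u * c \<le> b" by (simp add: ennreal_le_iff2)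
    then show ?thesis
      using real assms(2) by (auto intro!: ennreal_leI simp: pos_le_divide_eq)
  qed (use real in simp)
next
  case top
  with assms show ?thesis by (simp add: ennreal_top_mult top_unique)
qed

context stationary_rds
begin

text \<open>If doubling failed at all scales between \<open>2 powr -i\<close> and \<open>2 powr -((1 - \<delta>) * i)\<close>, the mass
  would fall by the factor \<open>C\<close> about \<open>\<delta> * i / 3\<close> times, hence below \<open>2 powr -(b * i)\<close> for large
  \<open>C\<close>.\<close>

lemma doubling_scales:
  assumes \<delta>: "0 < \<delta>" "\<delta> < 1" and b: "0 \<le> b"
    and low: "\<forall>\<^sub>F j in sequentially. 2 powr - (b * real j) \<le> ball_mass x (2 powr - real j)"
  shows "\<exists>C N. \<forall>i\<ge>N.
    \<exists>j. (1 - \<delta>) * real i \<le> real j \<and> j \<le> i \<and> x \<in> doubling_at C (2 powr - real j)"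
proof -
  define C where "C = nat \<lceil>2 powr (6 * b / \<delta> + 1) :: real\<rceil>"
  have C: "2 powr (6 * b / \<delta> + 1) \<le> real C"
    unfolding C_def by (rule of_nat_ceiling)
  obtain N where N: "\<And>j. N \<le> j \<Longrightarrow> 2 powr - (b * real j) \<le> ball_mass x (2 powr - real j)"
    using low unfolding eventually_sequentially by blast
  have "\<exists>j. (1 - \<delta>) * real i \<le> real j \<and> j \<le> i \<and> x \<in> doubling_at C (2 powr - real j)"
    if i: "N + nat \<lceil>6 / \<delta>\<rceil> + 1 \<le> i" for i
  proof (rule ccontr)
    assume "\<not> ?thesis"
    then have bad: "real C * ball_mass x (2 powr - real j) \<le> ball_mass x (8 * 2 powr - real j)"
      if "(1 - \<delta>) * real i \<le> real j" "j \<le> i" for j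
      using that by (force simp: doubling_at_def)
    \<comment> \<open>Radii that differ by the factor 8 differ by three dyadic steps.\<close>
    have chain: "real C ^ m * ball_mass x (2 powr - real i) \<le> ball_mass x (2 powr - (real i - 3 * real m))"
      if "3 * real m \<le> \<delta> * real i" for m
      using that
    proof (induction m)
      case (Suc m)
      have "\<delta> * real i \<le> real i" using \<delta> by (simp add: mult_left_le_one_le)
      with Suc.prems have le: "3 * m \<le> i" by simp
      have j: "real (i - 3 * m) = real i - 3 * real m" using le by (simp add: of_nat_diff)
      have "real C ^ Suc m * ball_mass x (2 powr - real i)
          \<le> real C * ball_mass x (2 powr - (real i - 3 * real m))"
        using Suc by (simp add: mult.assoc mult_left_mono)
      also have "\<dots> \<le> ball_mass x (8 * 2 powr - (real i - 3 * real m))"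
        using bad[of "i - 3 * m"] Suc.prems unfolding j by (simp add: algebra_simps)
      also have "8 * 2 powr - (real i - 3 * real m) = 2 powr - (real i - 3 * real (Suc m))"
      proof -
        have "8 * 2 powr - (real i - 3 * real m) = (2 powr (3 + - (real i - 3 * real m)) :: real)"
          by (simp only: powr_add) simp
        then show ?thesis by (simp add: algebra_simps)
      qed
      finally show ?case .
    qed simp
    define m where "m = nat \<lfloor>\<delta> * real i / 3\<rfloor>"
    have i6: "6 / \<delta> \<le> real i" using i by linarith
    then have i6': "6 \<le> \<delta> * real i" using \<delta> by (simp add: field_simps)
    have m: "3 * real m \<le> \<delta> * real i" "\<delta> * real i / 6 \<le> real m"
      unfolding m_def using i6' by linarith+
    have "b * real i + \<delta> * real i / 6 = (6 * b / \<delta> + 1) * (\<delta> * real i / 6)"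
      using \<delta> by (simp add: field_simps)
    then have "2 powr (b * real i + \<delta> * real i / 6) = (2 powr (6 * b / \<delta> + 1)) powr (\<delta> * real i / 6)"
      by (simp only: powr_powr)
    also have "\<dots> \<le> (2 powr (6 * b / \<delta> + 1)) powr real m"
      using m b \<delta> by (intro powr_mono ge_one_powr_ge_zero) auto
    also have "\<dots> = (2 powr (6 * b / \<delta> + 1)) ^ m" by (simp add: powr_realpow)
    also have "\<dots> \<le> real C ^ m" using C by (intro power_mono) auto
    finally have "2 powr (b * real i + \<delta> * real i / 6) * 2 powr - (b * real i)
        \<le> real C ^ m * ball_mass x (2 powr - real i)"
      using N[of i] i by (intro mult_mono) auto
    also have "\<dots> \<le> 1" using chain[OF m(1)] mu.prob_le_1 order_trans by blast
    finally have "2 powr (\<delta> * real i / 6) \<le> (1 :: real)" by (simp add: powr_add[symmetric])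
    moreover have "(1 :: real) < 2 powr (\<delta> * real i / 6)"
      using i6' powr_less_mono[of 0 "\<delta> * real i / 6" "2 :: real"] by simp
    ultimately show False by simp
  qed
  then show ?thesis by blast
qed

text \<open>The three properties that hold almost everywhere and from which the equalities follow at a
  single point: ball masses bounded below by a power of the radius, the Kac estimate, and summable
  probabilities of returns in the windows. Rational exponents keep the exceptional sets countable
  in number.\<close>

definition regular_point :: "'x \<Rightarrow> bool" where
  "regular_point x \<longleftrightarrow>
     (\<exists>b\<ge>0. \<forall>\<^sub>F j in sequentially. 2 powr - (b * real j) \<le> ball_mass x (2 powr - real j)) \<and>
     (\<forall>\<eta>>0. \<forall>C p. \<forall>\<^sub>F j in sequentially. x \<in> doubling_at C (2 powr - real j) \<longrightarrow>
        return_mean (8 * 2 powr - real j) p x * ball_mass x (2 powr - real j)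
          \<le> ennreal (2 powr (\<eta> * real j))) \<and>
     (\<forall>a\<in>\<rat>. \<forall>\<eta>\<in>\<rat>. 0 < a \<longrightarrow> 0 < \<eta> \<longrightarrow> (\<forall>C.
        (\<Sum>j. emeasure P (- avoiding (2 powr - real j) (return_window a \<eta> j) x)
           * indicator (thin_doubling C (2 powr - (a * real j)) (2 powr - real j)) x) \<noteq> \<top>))"

lemma AE_regular_point:
  assumes pack: "polynomial_packing K d (UNIV :: 'x set)" and corr: "correlation_bound \<rho>"
    and fast: "\<And>q. 0 < q \<Longrightarrow> (\<lambda>n. \<rho> n * real n powr q) \<longlonglongrightarrow> 0"
  shows "AE x in \<mu>. regular_point x"
proof -
  have mean: "AE x in \<mu>. \<forall>n C p. \<forall>\<^sub>F j in sequentially. x \<in> doubling_at C (2 powr - real j) \<longrightarrow>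
      return_mean (8 * 2 powr - real j) p x * ball_mass x (2 powr - real j)
        \<le> ennreal (2 powr (inverse (real (Suc n)) * real j))"
    unfolding AE_all_countable by (intro allI AE_eventually_return_mean_le[OF pack]) simp
  have window: "AE x in \<mu>. \<forall>a \<eta> C. 0 < real_of_rat a \<longrightarrow> 0 < real_of_rat \<eta> \<longrightarrow>
      (\<Sum>j. emeasure P (- avoiding (2 powr - real j) (return_window (real_of_rat a) (real_of_rat \<eta>) j) x)
         * indicator (thin_doubling C (2 powr - (real_of_rat a * real j)) (2 powr - real j)) x) \<noteq> \<top>"
    unfolding AE_all_countable
  proof (intro allI)
    fix a \<eta> :: rat and C
    show "AE x in \<mu>. 0 < real_of_rat a \<longrightarrow> 0 < real_of_rat \<eta> \<longrightarrow>
      (\<Sum>j. emeasure P (- avoiding (2 powr - real j) (return_window (real_of_rat a) (real_of_rat \<eta>) j) x)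
         * indicator (thin_doubling C (2 powr - (real_of_rat a * real j)) (2 powr - real j)) x) \<noteq> \<top>"
      using AE_summable_window_returns[OF pack corr fast, of "real_of_rat a" "real_of_rat \<eta>" C]
      by (cases "0 < real_of_rat a \<and> 0 < real_of_rat \<eta>") auto
  qed
  show ?thesis
    using AE_eventually_ball_mass_ge[OF pack] mean window
  proof eventually_elim
    case (elim x)
    have "\<forall>\<^sub>F j in sequentially. x \<in> doubling_at C (2 powr - real j) \<longrightarrow>
        return_mean (8 * 2 powr - real j) p x * ball_mass x (2 powr - real j)
          \<le> ennreal (2 powr (\<eta> * real j))" if \<eta>: "0 < \<eta>" for \<eta> C p
    proof -
      obtain n where n: "inverse (real (Suc n)) < \<eta>" using reals_Archimedean[OF \<eta>] by blast
      have "ennreal (2 powr (inverse (real (Suc n)) * real j)) \<le> ennreal (2 powr (\<eta> * real j))" for j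
        using n by (intro ennreal_leI powr_mono mult_right_mono) auto
      moreover have "\<forall>\<^sub>F j in sequentially. x \<in> doubling_at C (2 powr - real j) \<longrightarrow>
          return_mean (8 * 2 powr - real j) p x * ball_mass x (2 powr - real j)
            \<le> ennreal (2 powr (inverse (real (Suc n)) * real j))"
        using elim(2) by blast
      ultimately show ?thesis by (auto elim!: eventually_mono intro: order_trans)
    qed
    moreover have "\<exists>b\<ge>0. \<forall>\<^sub>F j in sequentially. 2 powr - (b * real j) \<le> ball_mass x (2 powr - real j)"
      using elim(1) of_nat_0_le_iff by blast
    ultimately show ?case
      unfolding regular_point_def using elim(3) by (auto simp: Rats_def)
  qed
qed

lemma regular_point_doubling_scales:
  assumes "regular_point x" "0 < \<delta>" "\<delta> < 1"
  shows "\<exists>C N. \<forall>i\<ge>N.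
    \<exists>j. (1 - \<delta>) * real i \<le> real j \<and> j \<le> i \<and> x \<in> doubling_at C (2 powr - real j)"
proof -
  obtain b where "0 \<le> b"
      "\<forall>\<^sub>F j in sequentially. 2 powr - (b * real j) \<le> ball_mass x (2 powr - real j)"
    using assms(1) unfolding regular_point_def by blast
  from doubling_scales[OF assms(2,3) this] show ?thesis by blast
qed

text \<open>The Kac estimate is applied at a doubling scale \<open>2 powr -j\<close> between \<open>\<rho> powr (1 + \<delta>)\<close> and
  \<open>\<rho> / 8\<close>. The return time at the radius \<open>8 * 2 powr -j\<close> is at least the one at \<open>\<rho>\<close>, and the mass
  at \<open>2 powr -j\<close> is at least the mass at \<open>\<rho> powr (1 + \<delta>)\<close>.\<close>

lemma return_mean_upper_estimate:
  assumes x: "regular_point x" and \<delta>: "0 < \<delta>" "\<delta> < 1" and \<eta>: "0 < \<eta>"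
  shows "\<forall>\<^sub>F \<rho> in at_right 0. \<rho> powr a \<le> ball_mass x (\<rho> powr (1 + \<delta>)) \<longrightarrow>
           return_mean \<rho> p x \<le> ennreal (\<rho> powr - (a + 2 * \<eta>))"
proof -
  obtain C N where scale: "\<And>i. N \<le> i \<Longrightarrow>
      \<exists>j. (1 - \<delta> / 4) * real i \<le> real j \<and> j \<le> i \<and> x \<in> doubling_at C (2 powr - real j)"
    using regular_point_doubling_scales[OF x, of "\<delta> / 4"] \<delta> by auto
  have "\<forall>\<^sub>F j in sequentially. x \<in> doubling_at C (2 powr - real j) \<longrightarrow>
      return_mean (8 * 2 powr - real j) p x * ball_mass x (2 powr - real j)
        \<le> ennreal (2 powr (\<eta> * real j))"
    using x \<eta> unfolding regular_point_def by blast
  then obtain N' where mean: "\<And>j. N' \<le> j \<Longrightarrow> x \<in> doubling_at C (2 powr - real j) \<Longrightarrow>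
      return_mean (8 * 2 powr - real j) p x * ball_mass x (2 powr - real j)
        \<le> ennreal (2 powr (\<eta> * real j))"
    unfolding eventually_sequentially by blast
  show ?thesis
  proof (rule eventually_at_right_dyadic[of "max (8 / \<delta>) (2 * real (N + N') + 1)"]; rule impI)
    fix L assume "max (8 / \<delta>) (2 * real (N + N') + 1) \<le> L"
    then have L: "8 / \<delta> \<le> L" "2 * real (N + N') + 1 \<le> L" by auto
    assume mass: "(2 powr - L) powr a \<le> ball_mass x ((2 powr - L) powr (1 + \<delta>))"
    have L\<delta>: "8 \<le> \<delta> * L" using L(1) \<delta> by (simp add: field_simps)
    have L0: "0 < L" using L(2) by simp
    \<comment> \<open>In dyadic exponents, \<open>\<rho> = 2 powr -L\<close>, and \<open>i\<close> is the scale of \<open>\<rho> powr (1 + \<delta>)\<close>.\<close>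
    define i where "i = nat \<lfloor>(1 + \<delta>) * L\<rfloor>"
    have "0 \<le> (1 + \<delta>) * L" using \<delta> L0 by simp
    then have i: "real i \<le> (1 + \<delta>) * L" "(1 + \<delta>) * L - 1 \<le> real i"
      unfolding i_def by linarith+
    have dL: "L \<le> (1 + \<delta>) * L" using \<delta> L0 by simp
    then have iN: "2 * real (N + N') \<le> real i" using i L(2) by linarith
    then obtain j where j: "(1 - \<delta> / 4) * real i \<le> real j" "j \<le> i" "x \<in> doubling_at C (2 powr - real j)"
      using scale[of i] by auto
    have "(1 / 2) * real i \<le> (1 - \<delta> / 4) * real i" using \<delta> by (intro mult_right_mono) auto
    also note j(1)
    finally have "real N' \<le> real j" using iN by simp
    then have jN: "N' \<le> j" by simp
    have "L + 3 \<le> real j"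
    proof -
      have "\<delta> * \<delta> \<le> \<delta>" using \<delta> by (simp add: mult_left_le_one_le)
      then have "\<delta> * \<delta> * L \<le> \<delta> * L" using L0 by (intro mult_right_mono) auto
      moreover have "(1 - \<delta> / 4) * ((1 + \<delta>) * L - 1)
          = L + 3 / 4 * (\<delta> * L) - 1 / 4 * (\<delta> * \<delta> * L) - 1 + \<delta> / 4"
        by (simp add: field_simps)
      moreover have "(1 - \<delta> / 4) * ((1 + \<delta>) * L - 1) \<le> (1 - \<delta> / 4) * real i"
        using i(2) \<delta> by (intro mult_left_mono) auto
      ultimately show ?thesis using j(1) L\<delta> \<delta> by linarith
    qed
    then have "8 * 2 powr - real j \<le> (2 powr - L :: real)"
    proof -
      assume le: "L + 3 \<le> real j"
      have "8 * 2 powr - real j = (2 powr (3 - real j) :: real)"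
        by (simp add: powr_diff powr_minus field_simps)
      also have "\<dots> \<le> 2 powr - L" using le by (intro powr_mono) auto
      finally show ?thesis .
    qed
    then have "return_mean (2 powr - L) p x \<le> return_mean (8 * 2 powr - real j) p x"
      by (rule return_mean_antimono)
    also have "\<dots> \<le> ennreal (2 powr (\<eta> * real j) / 2 powr - (a * L))"
    proof (rule ennreal_le_if_mult_le)
      have "2 powr - (a * L) = (2 powr - L) powr a" by (simp add: powr_powr mult.commute)
      also have "\<dots> \<le> ball_mass x ((2 powr - L) powr (1 + \<delta>))" by (rule mass)
      also have "(2 powr - L) powr (1 + \<delta>) = (2 powr - ((1 + \<delta>) * L) :: real)"
        by (simp add: powr_powr mult.commute)
      also have "ball_mass x (2 powr - ((1 + \<delta>) * L)) \<le> ball_mass x (2 powr - real j)"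
        using i(1) j(2) by (intro ball_mass_mono powr_mono) auto
      finally have "return_mean (8 * 2 powr - real j) p x * ennreal (2 powr - (a * L))
          \<le> return_mean (8 * 2 powr - real j) p x * ball_mass x (2 powr - real j)"
        by (intro mult_left_mono ennreal_leI) auto
      also have "\<dots> \<le> ennreal (2 powr (\<eta> * real j))" using mean[OF jN j(3)] .
      finally show "return_mean (8 * 2 powr - real j) p x * ennreal (2 powr - (a * L))
          \<le> ennreal (2 powr (\<eta> * real j))" .
    qed simp
    also have "\<dots> \<le> ennreal ((2 powr - L) powr - (a + 2 * \<eta>))"
    proof (rule ennreal_leI)
      have "real j \<le> 2 * L"
      proof -
        have "(1 + \<delta>) * L \<le> 2 * L" using \<delta> L0 by (intro mult_right_mono) auto
        then show ?thesis using i(1) j(2) by linarith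
      qed
      then have "\<eta> * real j \<le> \<eta> * (2 * L)" using \<eta> by (intro mult_left_mono) auto
      then have "2 powr (\<eta> * real j) / 2 powr - (a * L) \<le> 2 powr (\<eta> * (2 * L)) / 2 powr - (a * L)"
        by (intro divide_right_mono powr_mono) auto
      also have "\<dots> = (2 powr - L) powr - (a + 2 * \<eta>)"
        by (simp add: powr_powr powr_diff[symmetric] algebra_simps)
      finally show "2 powr (\<eta> * real j) / 2 powr - (a * L) \<le> (2 powr - L) powr - (a + 2 * \<eta>)" .
    qed
    finally show "return_mean (2 powr - L) p x \<le> ennreal ((2 powr - L) powr - (a + 2 * \<eta>))" .
  qed
qed

end

section \<open>The lower estimate\<close>

context stationary_rds
begin

text \<open>The probabilities of returns in the windows are summable, so beyond some \<open>J\<close> their sum is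
  below 1/4; outside an event of that probability, no window of a thin doubling scale beyond \<open>J\<close>
  has a return. A radius \<open>\<rho>\<close> inherits this from a doubling scale between \<open>\<rho>\<close> and
  \<open>\<rho> powr (1 - \<delta>) / 8\<close>.\<close>

lemma avoiding_windows:
  assumes x: "regular_point x" and \<delta>: "0 < \<delta>" "\<delta> < 1"
    and rat: "a \<in> \<rat>" "\<eta> \<in> \<rat>" and pos: "0 < \<eta>" "\<eta> \<le> a"
  obtains W where "W \<in> sets P" "emeasure P (- W) \<le> ennreal (1 / 4)"
    "\<forall>\<^sub>F \<rho> in at_right 0. ball_mass x (\<rho> powr (1 - \<delta>)) \<le> \<rho> powr a \<longrightarrow>
       (\<forall>\<omega>\<in>W. \<forall>k. \<rho> powr - \<eta> \<le> real k \<longrightarrow> real k \<le> \<rho> powr - ((1 - \<delta>) * (a - \<eta>)) \<longrightarrow>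
          \<rho> \<le> dist (orbit k \<omega> x) x)"
proof -
  obtain C N where scale: "\<And>i. N \<le> i \<Longrightarrow>
      \<exists>j. (1 - \<delta> / 2) * real i \<le> real j \<and> j \<le> i \<and> x \<in> doubling_at C (2 powr - real j)"
    using regular_point_doubling_scales[OF x, of "\<delta> / 2"] \<delta> by auto
  define bad where "bad j = (if x \<in> thin_doubling C (2 powr - (a * real j)) (2 powr - real j)
      then - avoiding (2 powr - real j) (return_window a \<eta> j) x else {})" for j :: nat
  have bad_sets: "bad j \<in> sets P" for j by (simp add: bad_def)
  have "0 < a" using pos by simp
  then have "(\<Sum>j. emeasure P (- avoiding (2 powr - real j) (return_window a \<eta> j) x)
      * indicator (thin_doubling C (2 powr - (a * real j)) (2 powr - real j)) x) \<noteq> \<top>"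
    using x rat pos unfolding regular_point_def by blast
  also have "(\<lambda>j. emeasure P (- avoiding (2 powr - real j) (return_window a \<eta> j) x)
      * indicator (thin_doubling C (2 powr - (a * real j)) (2 powr - real j)) x)
      = (\<lambda>j. ennreal (prob (bad j)))"
    by (auto simp: bad_def indicator_def emeasure_eq_measure)
  finally have "summable (\<lambda>j. prob (bad j))"
    by (intro summable_suminf_not_top) auto
  then have sm: "summable (\<lambda>j. prob (bad (j + k)))" for k by (rule summable_ignore_initial_segment)
  obtain J where "norm (\<Sum>j. prob (bad (j + J))) < 1 / 4"
    using suminf_exist_split[of "1 / 4" "\<lambda>j. prob (bad j)"] sm[of 0] by auto
  then have J: "(\<Sum>j. prob (bad (j + J))) < 1 / 4"
    unfolding real_norm_def by linarith
  define W where "W = - (\<Union>j. bad (j + J))"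
  have "W \<in> sets P"
    using sets.compl_sets[of "\<Union>j. bad (j + J)" P] bad_sets
    by (auto simp: W_def Compl_eq_Diff_UNIV)
  moreover have "emeasure P (- W) \<le> ennreal (1 / 4)"
  proof -
    have "emeasure P (- W) \<le> (\<Sum>j. emeasure P (bad (j + J)))"
      unfolding W_def double_complement using bad_sets by (intro emeasure_subadditive_countably) auto
    also have "\<dots> = ennreal (\<Sum>j. prob (bad (j + J)))"
      unfolding emeasure_eq_measure using sm by (intro suminf_ennreal2) auto
    also have "\<dots> \<le> ennreal (1 / 4)" using J by (intro ennreal_leI) simp
    finally show ?thesis .
  qed
  moreover have "\<forall>\<^sub>F \<rho> in at_right 0. ball_mass x (\<rho> powr (1 - \<delta>)) \<le> \<rho> powr a \<longrightarrow>
       (\<forall>\<omega>\<in>W. \<forall>k. \<rho> powr - \<eta> \<le> real k \<longrightarrow> real k \<le> \<rho> powr - ((1 - \<delta>) * (a - \<eta>)) \<longrightarrow>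
          \<rho> \<le> dist (orbit k \<omega> x) x)"
  proof (rule eventually_at_right_dyadic[of "max (8 / \<delta>) (2 * real (N + J) + 1)"];
      intro impI ballI allI)
    fix L \<omega> k assume "max (8 / \<delta>) (2 * real (N + J) + 1) \<le> L"
    then have L: "8 / \<delta> \<le> L" "2 * real (N + J) + 1 \<le> L" by auto
    assume mass: "ball_mass x ((2 powr - L) powr (1 - \<delta>)) \<le> (2 powr - L) powr a"
      and \<omega>: "\<omega> \<in> W" and k1: "(2 powr - L) powr - \<eta> \<le> real k"
      and k2: "real k \<le> (2 powr - L) powr - ((1 - \<delta>) * (a - \<eta>))"
    have L\<delta>: "8 \<le> \<delta> * L" using L(1) \<delta> by (simp add: field_simps)
    have L0: "0 < L" using L(2) by simp
    define i where "i = nat \<lfloor>L\<rfloor>"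
    have i: "real i \<le> L" "L - 1 \<le> real i" unfolding i_def using L0 by linarith+
    then have iN: "2 * real (N + J) \<le> real i" using L(2) by linarith
    then obtain j where j: "(1 - \<delta> / 2) * real i \<le> real j" "j \<le> i" "x \<in> doubling_at C (2 powr - real j)"
      using scale[of i] by auto
    have "(1 / 2) * real i \<le> (1 - \<delta> / 2) * real i" using \<delta> by (intro mult_right_mono) auto
    also note j(1)
    finally have "real J \<le> real j" using iN by simp
    then have jJ: "J \<le> j" by simp
    have jL: "real j \<le> L" using j(2) i(1) by linarith
    have jlow: "(1 - \<delta>) * L + 3 \<le> real j"
    proof -
      have "(1 - \<delta> / 2) * (L - 1) \<le> (1 - \<delta> / 2) * real i"
        using i(2) \<delta> by (intro mult_left_mono) auto
      moreover have "(1 - \<delta> / 2) * (L - 1) = (1 - \<delta>) * L + 1 / 2 * (\<delta> * L) - 1 + \<delta> / 2"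
        by (simp add: field_simps)
      ultimately show ?thesis using j(1) L\<delta> \<delta> by linarith
    qed
    have "ball_mass x (8 * 2 powr - real j) \<le> 2 powr - (a * real j)"
    proof -
      have "8 * 2 powr - real j = (2 powr (3 - real j) :: real)"
        by (simp add: powr_diff powr_minus field_simps)
      also have "\<dots> \<le> 2 powr - ((1 - \<delta>) * L)" using jlow by (intro powr_mono) auto
      also have "\<dots> = (2 powr - L) powr (1 - \<delta>)" by (simp add: powr_powr mult.commute)
      finally have "ball_mass x (8 * 2 powr - real j) \<le> ball_mass x ((2 powr - L) powr (1 - \<delta>))"
        by (rule ball_mass_mono)
      also have "\<dots> \<le> (2 powr - L) powr a" by (rule mass)
      also have "\<dots> = 2 powr - (a * L)" by (simp add: powr_powr mult.commute)
      also have "\<dots> \<le> 2 powr - (a * real j)"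
        using jL \<open>0 < a\<close> by (intro powr_mono) auto
      finally show ?thesis .
    qed
    then have "x \<in> thin_doubling C (2 powr - (a * real j)) (2 powr - real j)"
      using j(3) by (simp add: thin_doubling_def)
    moreover have "\<omega> \<notin> bad j"
    proof -
      have "\<omega> \<notin> bad ((j - J) + J)" using \<omega> unfolding W_def by blast
      then show ?thesis using jJ by simp
    qed
    ultimately have "\<omega> \<in> avoiding (2 powr - real j) (return_window a \<eta> j) x"
      by (simp add: bad_def)
    moreover have "k \<in> return_window a \<eta> j"
    proof -
      have "2 powr (\<eta> * real j) \<le> 2 powr (\<eta> * L)"
        using jL pos by (intro powr_mono mult_left_mono) auto
      also have "\<dots> = (2 powr - L) powr - \<eta>" by (simp add: powr_powr mult.commute)
      finally have 1: "2 powr (\<eta> * real j) \<le> real k" using k1 by linarith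
      have "(2 powr - L) powr - ((1 - \<delta>) * (a - \<eta>)) = 2 powr ((a - \<eta>) * ((1 - \<delta>) * L))"
        by (simp add: powr_powr mult_ac)
      also have "\<dots> \<le> 2 powr ((a - \<eta>) * real j)"
        using jlow pos by (intro powr_mono mult_left_mono) auto
      finally have "real k \<le> 2 powr ((a - \<eta>) * real j)" using k2 by linarith
      with 1 show ?thesis by (simp add: return_window_def)
    qed
    ultimately have "2 powr - real j \<le> dist (orbit k \<omega> x) x"
      unfolding avoiding_def by blast
    moreover have "2 powr - L \<le> (2 powr - real j :: real)" using jL by (intro powr_mono) auto
    ultimately show "2 powr - L \<le> dist (orbit k \<omega> x) x" by linarith
  qed
  ultimately show ?thesis using that by blast
qed

text \<open>The exponent \<open>a\<^sub>0\<close> holds at all small radii and serves to exclude early returns: a time \<open>k\<close>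
  that precedes the window of \<open>\<rho>\<close> lies at the beginning of the window of the larger radius
  \<open>k powr -(1 / \<eta>)\<close>, which is within reach as soon as \<open>k > p\<close>. The exponent \<open>a\<close> holds at the
  radius \<open>\<rho>\<close> under consideration and excludes returns in the window of \<open>\<rho>\<close> itself. Both exclusions
  hold with probability at least 1/2.\<close>

lemma return_mean_lower_estimate:
  assumes x: "regular_point x" and \<delta>: "0 < \<delta>" "\<delta> < 1"
    and rat: "a \<in> \<rat>" "a\<^sub>0 \<in> \<rat>" "\<eta> \<in> \<rat>"
    and \<eta>: "0 < \<eta>" "\<eta> \<le> a" "\<eta> \<le> (1 - \<delta>) * (a\<^sub>0 - \<eta>)"
    and thin: "\<forall>\<^sub>F \<rho> in at_right 0. ball_mass x (\<rho> powr (1 - \<delta>)) \<le> \<rho> powr a\<^sub>0"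
  shows "\<exists>p. \<forall>\<^sub>F \<rho> in at_right 0. ball_mass x (\<rho> powr (1 - \<delta>)) \<le> \<rho> powr a \<longrightarrow>
           ennreal (\<rho> powr - ((1 - \<delta>) * (a - \<eta>)) / 2) \<le> return_mean \<rho> p x"
proof -
  define \<beta>\<^sub>0 where "\<beta>\<^sub>0 = (1 - \<delta>) * (a\<^sub>0 - \<eta>)"
  define \<beta> where "\<beta> = (1 - \<delta>) * (a - \<eta>)"
  have "0 < a\<^sub>0 - \<eta>" using \<eta> \<delta> by (smt (verit) mult_nonneg_nonpos)
  then have "\<eta> \<le> a\<^sub>0" by simp
  obtain W\<^sub>0 where W\<^sub>0: "W\<^sub>0 \<in> sets P" "emeasure P (- W\<^sub>0) \<le> ennreal (1 / 4)"
    and clean\<^sub>0: "\<forall>\<^sub>F \<rho> in at_right 0. ball_mass x (\<rho> powr (1 - \<delta>)) \<le> \<rho> powr a\<^sub>0 \<longrightarrow>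
       (\<forall>\<omega>\<in>W\<^sub>0. \<forall>k. \<rho> powr - \<eta> \<le> real k \<longrightarrow> real k \<le> \<rho> powr - \<beta>\<^sub>0 \<longrightarrow>
          \<rho> \<le> dist (orbit k \<omega> x) x)"
    unfolding \<beta>\<^sub>0_def by (rule avoiding_windows[OF x \<delta> rat(2,3) \<eta>(1) \<open>\<eta> \<le> a\<^sub>0\<close>])
  obtain W where W: "W \<in> sets P" "emeasure P (- W) \<le> ennreal (1 / 4)"
    and clean: "\<forall>\<^sub>F \<rho> in at_right 0. ball_mass x (\<rho> powr (1 - \<delta>)) \<le> \<rho> powr a \<longrightarrow>
       (\<forall>\<omega>\<in>W. \<forall>k. \<rho> powr - \<eta> \<le> real k \<longrightarrow> real k \<le> \<rho> powr - \<beta> \<longrightarrow>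
          \<rho> \<le> dist (orbit k \<omega> x) x)"
    unfolding \<beta>_def by (rule avoiding_windows[OF x \<delta> rat(1,3) \<eta>(1,2)])
  have "\<forall>\<^sub>F \<rho> in at_right 0. \<forall>\<omega>\<in>W\<^sub>0. \<forall>k. \<rho> powr - \<eta> \<le> real k \<longrightarrow> real k \<le> \<rho> powr - \<beta>\<^sub>0 \<longrightarrow>
      \<rho> \<le> dist (orbit k \<omega> x) x"
    using clean\<^sub>0 thin by eventually_elim blast
  then obtain b where b: "0 < b" and clean_b: "\<And>\<rho> \<omega> k. 0 < \<rho> \<Longrightarrow> \<rho> < b \<Longrightarrow> \<omega> \<in> W\<^sub>0 \<Longrightarrow>
      \<rho> powr - \<eta> \<le> real k \<Longrightarrow> real k \<le> \<rho> powr - \<beta>\<^sub>0 \<Longrightarrow> \<rho> \<le> dist (orbit k \<omega> x) x"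
    unfolding eventually_at_right_field by blast
  \<comment> \<open>For \<open>k > p\<close>, the radius \<open>k powr -(1 / \<eta>)\<close> whose window begins at \<open>k\<close> is below \<open>b\<close>.\<close>
  define p where "p = nat \<lceil>b powr - \<eta>\<rceil>"
  have p: "b powr - \<eta> \<le> real p" unfolding p_def by (rule of_nat_ceiling)
  have half: "ennreal (1 / 2) \<le> emeasure P (W\<^sub>0 \<inter> W)"
  proof -
    have meas: "W\<^sub>0 \<inter> W \<in> sets P" "- W\<^sub>0 \<in> sets P" "- W \<in> sets P"
      using W\<^sub>0(1) W(1) sets.compl_sets[of _ P] by (auto simp: Compl_eq_Diff_UNIV)
    have cover: "(W\<^sub>0 \<inter> W) \<union> (- W\<^sub>0 \<union> - W) = space P" by auto
    have "1 = prob ((W\<^sub>0 \<inter> W) \<union> (- W\<^sub>0 \<union> - W))"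
      unfolding cover by (rule prob_space[symmetric])
    also have "\<dots> \<le> prob (W\<^sub>0 \<inter> W) + (prob (- W\<^sub>0) + prob (- W))"
      using meas by (intro order_trans[OF measure_Un_le] add_left_mono
          measure_Un_le) auto
    also have "prob (- W\<^sub>0) + prob (- W) \<le> 1 / 4 + 1 / 4"
      using W\<^sub>0(2) W(2) by (intro add_mono) (simp_all add: emeasure_eq_measure)
    finally have "1 / 2 \<le> prob (W\<^sub>0 \<inter> W)" by simp
    then show ?thesis unfolding emeasure_eq_measure by (rule ennreal_leI)
  qed
  have "\<forall>\<^sub>F \<rho> in at_right 0. ball_mass x (\<rho> powr (1 - \<delta>)) \<le> \<rho> powr a \<longrightarrow>
      ennreal (\<rho> powr - \<beta> / 2) \<le> return_mean \<rho> p x"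
    using clean eventually_at_right_real[OF b]
  proof eventually_elim
    case (elim \<rho>)
    show ?case
    proof
      assume mass: "ball_mass x (\<rho> powr (1 - \<delta>)) \<le> \<rho> powr a"
      have \<rho>: "0 < \<rho>" "\<rho> < b" using elim(2) by auto
      define N where "N = nat \<lfloor>\<rho> powr - \<beta>\<rfloor>"
      have "0 \<le> \<rho> powr - \<beta>" by simp
      then have N: "real N \<le> \<rho> powr - \<beta>" "\<rho> powr - \<beta> \<le> real (Suc N)"
        unfolding N_def by linarith+
      have far: "\<rho> \<le> dist (orbit k \<omega> x) x" if \<omega>: "\<omega> \<in> W\<^sub>0 \<inter> W" and k: "k \<in> {p<..N}" for \<omega> k
      proof (cases "\<rho> powr - \<eta> \<le> real k")
        case True
        have "real k \<le> \<rho> powr - \<beta>" using k N(1) by simp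
        with True elim(1) mass \<omega> show ?thesis by blast
      next
        case False
        define s where "s = real k powr - (1 / \<eta>)"
        have k1: "1 \<le> real k" using k by simp
        have s: "0 < s" using k1 by (simp add: s_def)
        have sk: "s powr - \<eta> = real k" using k1 \<eta>(1) by (simp add: s_def powr_powr)
        have "s < b"
        proof (rule ccontr)
          assume "\<not> s < b"
          then have "s powr - \<eta> \<le> b powr - \<eta>" using b \<eta>(1) by (intro powr_mono2') auto
          then show False using sk p k by simp
        qed
        moreover have "\<rho> \<le> s"
        proof (rule ccontr)
          assume "\<not> \<rho> \<le> s"
          then have "\<rho> powr - \<eta> \<le> s powr - \<eta>" using s \<eta>(1) by (intro powr_mono2') auto
          then show False using sk False by simp
        qed
        moreover have "real k \<le> s powr - \<beta>\<^sub>0"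
        proof -
          have "s powr - \<beta>\<^sub>0 = real k powr (\<beta>\<^sub>0 / \<eta>)" by (simp add: s_def powr_powr)
          moreover have "1 \<le> \<beta>\<^sub>0 / \<eta>" using \<eta> by (simp add: \<beta>\<^sub>0_def)
          ultimately show ?thesis using powr_mono[of 1 "\<beta>\<^sub>0 / \<eta>" "real k"] k1 by simp
        qed
        ultimately show ?thesis using clean_b[of s \<omega> k] s sk \<omega> by auto
      qed
      then have "W\<^sub>0 \<inter> W \<subseteq> avoiding \<rho> {p<..N} x" unfolding avoiding_def by blast
      then have "emeasure P (W\<^sub>0 \<inter> W) \<le> emeasure P (avoiding \<rho> {p<..N} x)"
        by (intro emeasure_mono) auto
      with half have "ennreal (1 / 2) \<le> emeasure P (avoiding \<rho> {p<..N} x)" by (rule order_trans)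
      then have "of_nat (Suc N) * ennreal (1 / 2) \<le> return_mean \<rho> p x" by (rule return_mean_ge)
      moreover have "ennreal (\<rho> powr - \<beta> / 2) \<le> of_nat (Suc N) * ennreal (1 / 2)"
        using N(2) by (simp only: ennreal_of_nat_eq_real_of_nat flip: ennreal_mult) (intro ennreal_leI, simp)
      ultimately show "ennreal (\<rho> powr - \<beta> / 2) \<le> return_mean \<rho> p x" by (rule order_trans[rotated])
    qed
  qed
  then show ?thesis by (auto simp: \<beta>_def)
qed

end

section \<open>Recurrence rates and local dimensions\<close>

lemma log_ratio_greater:
  assumes r: "0 < r" "r < 1" and m: "0 \<le> m" and "ereal c < eln (ennreal m) / ereal (ln r)"
  shows "m \<le> r powr c"
proof (cases "m = 0")
  case False
  then have m: "0 < m" using m by simp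
  have lr: "ln r < 0" using r by simp
  have "c < ln m / ln r"
    using assms(4) m lr by (simp add: eln_def)
  then have "ln m \<le> c * ln r" using lr by (simp add: field_simps)
  then have "exp (ln m) \<le> exp (c * ln r)" by simp
  then show ?thesis using m r by (simp add: powr_def)
qed simp

lemma log_ratio_less:
  assumes r: "0 < r" "r < 1" and m: "0 \<le> m" and less: "eln (ennreal m) / ereal (ln r) < ereal c"
  shows "r powr c \<le> m"
proof -
  have lr: "ln r < 0" using r by simp
  have "m \<noteq> 0"
  proof
    assume "m = 0"
    then have "eln (ennreal m) / ereal (ln r) = \<infinity>"
      using lr by (simp add: eln_def ereal_divide_eq)
    with less show False by simp
  qed
  then have m: "0 < m" using m by simp
  have "ln m / ln r < c"
    using less m lr by (simp add: eln_def)
  then have "c * ln r \<le> ln m" using lr by (simp add: field_simps)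
  then have "exp (c * ln r) \<le> exp (ln m)" by simp
  then show ?thesis using m r by (simp add: powr_def)
qed

lemma eln_powr_ratio:
  assumes r: "0 < r" "r < 1"
  shows "eln (ennreal (r powr - c)) / ereal (- ln r) = ereal c"
proof -
  have "ln (r powr - c) = - c * ln r" using r by (simp add: ln_powr)
  moreover have "ln r \<noteq> 0" using r by simp
  ultimately show ?thesis using r by (simp add: eln_def)
qed

lemma log_rate_le:
  assumes r: "0 < r" "r < 1" and "t \<le> ennreal (r powr - c)"
  shows "eln t / ereal (- ln r) \<le> ereal c"
proof -
  have "eln t / ereal (- ln r) \<le> eln (ennreal (r powr - c)) / ereal (- ln r)"
    using assms by (intro ereal_divide_right_mono eln_mono) auto
  then show ?thesis by (simp only: eln_powr_ratio[OF r])
qed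

lemma log_rate_ge:
  assumes r: "0 < r" "r < 1" and "ennreal (r powr - c) \<le> t"
  shows "ereal c \<le> eln t / ereal (- ln r)"
proof -
  have "eln (ennreal (r powr - c)) / ereal (- ln r) \<le> eln t / ereal (- ln r)"
    using assms by (intro ereal_divide_right_mono eln_mono) auto
  then show ?thesis by (simp only: eln_powr_ratio[OF r])
qed

lemma lower_recurrence_rate_eq_SUP:
  "lower_recurrence_rate P \<theta> T x = (SUP p. Liminf (at_right 0)
     (\<lambda>r. eln (annealed_return_time P \<theta> T r p x) / ereal (- ln r)))"
  and upper_recurrence_rate_eq_SUP:
  "upper_recurrence_rate P \<theta> T x = (SUP p. Limsup (at_right 0)
     (\<lambda>r. eln (annealed_return_time P \<theta> T r p x) / ereal (- ln r)))"
proof -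
  have ev: "\<forall>\<^sub>F r in at_right 0. eln (annealed_return_time P \<theta> T r p x) / ereal (- ln r)
      \<le> eln (annealed_return_time P \<theta> T r q x) / ereal (- ln r)" if "p \<le> q" for p q
    using eventually_at_right_real[of 0 "1 :: real", OF zero_less_one]
    by eventually_elim (intro ereal_divide_right_mono eln_mono annealed_return_time_mono that, simp)
  show "lower_recurrence_rate P \<theta> T x = (SUP p. Liminf (at_right 0)
     (\<lambda>r. eln (annealed_return_time P \<theta> T r p x) / ereal (- ln r)))"
    unfolding lower_recurrence_rate_def
    by (rule limI[OF LIMSEQ_SUP]) (intro monoI Liminf_mono ev)
  show "upper_recurrence_rate P \<theta> T x = (SUP p. Limsup (at_right 0)
     (\<lambda>r. eln (annealed_return_time P \<theta> T r p x) / ereal (- ln r)))"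
    unfolding upper_recurrence_rate_def
    by (rule limI[OF LIMSEQ_SUP]) (intro monoI Limsup_mono ev)
qed

context stationary_rds
begin

abbreviation local_exponent :: "'x \<Rightarrow> real \<Rightarrow> ereal" where
  "local_exponent x r \<equiv> eln (emeasure \<mu> (ball x r)) / ereal (ln r)"

abbreviation return_exponent :: "nat \<Rightarrow> 'x \<Rightarrow> real \<Rightarrow> ereal" where
  "return_exponent p x r \<equiv> eln (return_mean r p x) / ereal (- ln r)"

lemma return_exponent_upper:
  assumes x: "regular_point x" and c: "0 < c" "c < y"
  obtains s where "0 < s"
    "\<And>p. \<forall>\<^sub>F \<rho> in at_right 0. local_exponent x (\<rho> powr s) < ereal c \<longrightarrow> return_exponent p x \<rho> \<le> ereal y"
proof -
  define \<delta> where "\<delta> = min (1 / 2) ((y - c) / (2 * c))"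
  define \<eta> where "\<eta> = (y - c) / 4"
  have \<delta>: "0 < \<delta>" "\<delta> < 1" and \<eta>: "0 < \<eta>" using c by (auto simp: \<delta>_def \<eta>_def min_def)
  have "\<delta> * c \<le> (y - c) / (2 * c) * c" using c by (intro mult_right_mono) (auto simp: \<delta>_def)
  also have "\<dots> = (y - c) / 2" using c by simp
  finally have \<delta>c: "(1 + \<delta>) * c + 2 * \<eta> \<le> y" by (simp add: \<eta>_def algebra_simps) argo
  have "\<forall>\<^sub>F \<rho> in at_right 0. local_exponent x (\<rho> powr (1 + \<delta>)) < ereal c \<longrightarrow>
      return_exponent p x \<rho> \<le> ereal y" for p
    using return_mean_upper_estimate[OF x \<delta> \<eta>, of "(1 + \<delta>) * c" p]
      eventually_at_right_real[of 0 "1 :: real", OF zero_less_one]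
  proof eventually_elim
    case (elim \<rho>)
    then have \<rho>: "0 < \<rho>" "\<rho> < 1" by auto
    show ?case
    proof
      assume less: "local_exponent x (\<rho> powr (1 + \<delta>)) < ereal c"
      have "\<rho> powr (1 + \<delta>) < 1"
        using powr_less_mono2[of "1 + \<delta>" \<rho> 1] \<rho> \<delta> by simp
      then have "(\<rho> powr (1 + \<delta>)) powr c \<le> ball_mass x (\<rho> powr (1 + \<delta>))"
        using less \<rho> by (intro log_ratio_less) (auto simp: mu.emeasure_eq_measure)
      then have "return_mean \<rho> p x \<le> ennreal (\<rho> powr - ((1 + \<delta>) * c + 2 * \<eta>))"
        using elim(1) by (simp add: powr_powr)
      then have "return_exponent p x \<rho> \<le> ereal ((1 + \<delta>) * c + 2 * \<eta>)"
        by (rule log_rate_le[OF \<rho>])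
      also have "\<dots> \<le> ereal y" using \<delta>c by simp
      finally show "return_exponent p x \<rho> \<le> ereal y" .
    qed
  qed
  then show ?thesis using that[of "1 + \<delta>"] \<delta> by simp
qed

text \<open>A positive lower dimension supplies the exponent \<open>c\<^sub>0\<close> that holds at all small radii. The
  rational parameters are close enough to \<open>c\<close> and \<open>c\<^sub>0\<close> that the losses \<open>\<delta>\<close> and \<open>\<eta>\<close> leave the
  exponent \<open>\<beta>\<close> above \<open>y\<close>; this strict inequality absorbs the factor 1/2.\<close>

lemma return_exponent_lower:
  assumes x: "regular_point x" and dim: "0 < lower_local_dim \<mu> x" and c: "0 < c" "y < c"
  obtains s p where "0 < s"
    "\<forall>\<^sub>F \<rho> in at_right 0. ereal c < local_exponent x (\<rho> powr s) \<longrightarrow> ereal y \<le> return_exponent p x \<rho>"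
proof -
  obtain c\<^sub>0 where c\<^sub>0: "0 < c\<^sub>0" "ereal c\<^sub>0 < lower_local_dim \<mu> x"
    using ereal_dense2[OF dim] by auto
  define z where "z = max y (c / 2)"
  define \<Delta> where "\<Delta> = c - z"
  have \<Delta>: "0 < \<Delta>" "\<Delta> \<le> c / 2" "y \<le> c - \<Delta>" using c by (auto simp: \<Delta>_def z_def)
  define \<delta> where "\<delta> = \<Delta> / (4 * c)"
  have \<delta>: "0 < \<delta>" "\<delta> \<le> 1 / 4" "\<delta> * c = \<Delta> / 4" using \<Delta> c by (auto simp: \<delta>_def field_simps)
  obtain \<eta> where \<eta>: "\<eta> \<in> \<rat>" "0 < \<eta>" "\<eta> < min (\<Delta> / 8) (c\<^sub>0 / 8)"
    using Rats_dense_in_real[of 0 "min (\<Delta> / 8) (c\<^sub>0 / 8)"] \<Delta> c\<^sub>0 by auto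
  obtain a where a: "a \<in> \<rat>" "c - \<Delta> / 2 < a" "a < c - \<Delta> / 4"
    using Rats_dense_in_real[of "c - \<Delta> / 2" "c - \<Delta> / 4"] \<Delta> by auto
  obtain a\<^sub>0 where a\<^sub>0: "a\<^sub>0 \<in> \<rat>" "c\<^sub>0 / 2 < a\<^sub>0" "a\<^sub>0 < 3 / 4 * c\<^sub>0"
    using Rats_dense_in_real[of "c\<^sub>0 / 2" "3 / 4 * c\<^sub>0"] c\<^sub>0 by auto
  have \<eta>a: "\<eta> \<le> a" using \<eta> a \<Delta> by simp
  have \<eta>a\<^sub>0: "\<eta> \<le> (1 - \<delta>) * (a\<^sub>0 - \<eta>)"
  proof -
    have "3 / 4 * (3 / 8 * c\<^sub>0) \<le> (1 - \<delta>) * (a\<^sub>0 - \<eta>)"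
      using \<delta> a\<^sub>0 \<eta> c\<^sub>0 by (intro mult_mono) auto
    then show ?thesis using \<eta> c\<^sub>0 by simp
  qed
  have thin: "ball_mass x (\<rho> powr (1 - \<delta>)) \<le> \<rho> powr b"
    if "0 < \<rho>" "\<rho> < 1" "b \<le> (1 - \<delta>) * e" "ereal e < local_exponent x (\<rho> powr (1 - \<delta>))" for \<rho> b e
  proof -
    have "\<rho> powr (1 - \<delta>) < 1" using powr_less_mono2[of "1 - \<delta>" \<rho> 1] that \<delta> by simp
    then have "ball_mass x (\<rho> powr (1 - \<delta>)) \<le> (\<rho> powr (1 - \<delta>)) powr e"
      using that by (intro log_ratio_greater) (auto simp: mu.emeasure_eq_measure)
    also have "\<dots> \<le> \<rho> powr b" using that by (simp add: powr_powr powr_mono')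
    finally show ?thesis .
  qed
  have unit: "\<forall>\<^sub>F \<rho> in at_right (0 :: real). \<rho> \<in> {0<..<1}"
    by (rule eventually_at_right_real) simp
  have "\<forall>\<^sub>F r in at_right 0. ereal c\<^sub>0 < local_exponent x r"
    using c\<^sub>0(2) unfolding lower_local_dim_def by (rule less_LiminfD)
  then have "\<forall>\<^sub>F \<rho> in at_right 0. ereal c\<^sub>0 < local_exponent x (\<rho> powr (1 - \<delta>))"
    using \<delta> by (subst eventually_at_right_powr_iff) auto
  then have thin\<^sub>0: "\<forall>\<^sub>F \<rho> in at_right 0. ball_mass x (\<rho> powr (1 - \<delta>)) \<le> \<rho> powr a\<^sub>0"
    using unit
  proof eventually_elim
    case (elim \<rho>)
    have "3 / 4 * c\<^sub>0 \<le> (1 - \<delta>) * c\<^sub>0" using \<delta> c\<^sub>0 by (intro mult_right_mono) auto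
    then have "a\<^sub>0 \<le> (1 - \<delta>) * c\<^sub>0" using a\<^sub>0 by linarith
    then show ?case using elim thin[of \<rho> a\<^sub>0 c\<^sub>0] by simp
  qed
  define \<beta> where "\<beta> = (1 - \<delta>) * (a - \<eta>)"
  have y\<beta>: "y < \<beta>"
  proof -
    have "\<delta> * (a - \<eta>) \<le> \<delta> * c" using a \<eta> \<Delta> \<delta> by (intro mult_left_mono) auto
    then have "a - \<eta> - \<Delta> / 4 \<le> \<beta>" using \<delta>(3) by (simp add: \<beta>_def algebra_simps)
    then show ?thesis using a \<eta> \<Delta> by simp
  qed
  have "\<delta> < 1" using \<delta> by simp
  from return_mean_lower_estimate[OF x \<delta>(1) this a(1) a\<^sub>0(1) \<eta>(1,2) \<eta>a \<eta>a\<^sub>0 thin\<^sub>0]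
  obtain p where p: "\<forall>\<^sub>F \<rho> in at_right 0. ball_mass x (\<rho> powr (1 - \<delta>)) \<le> \<rho> powr a \<longrightarrow>
      ennreal (\<rho> powr - \<beta> / 2) \<le> return_mean \<rho> p x"
    by (auto simp: \<beta>_def)
  have small: "\<forall>\<^sub>F \<rho> in at_right 0. \<rho> \<in> {0<..<(1 / 2) powr (1 / (\<beta> - y))}"
    by (rule eventually_at_right_real) simp
  have "\<forall>\<^sub>F \<rho> in at_right 0. ereal c < local_exponent x (\<rho> powr (1 - \<delta>)) \<longrightarrow>
      ereal y \<le> return_exponent p x \<rho>"
    using p unit small
  proof eventually_elim
    case (elim \<rho>)
    then have \<rho>: "0 < \<rho>" "\<rho> < 1" by auto
    show ?case
    proof
      assume "ereal c < local_exponent x (\<rho> powr (1 - \<delta>))"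
      moreover have "a \<le> (1 - \<delta>) * c" using a \<delta>(3) by (simp add: algebra_simps)
      ultimately have "ball_mass x (\<rho> powr (1 - \<delta>)) \<le> \<rho> powr a" using thin[OF \<rho>] by blast
      then have "ennreal (\<rho> powr - \<beta> / 2) \<le> return_mean \<rho> p x" using elim(1) by blast
      moreover have "\<rho> powr - y \<le> \<rho> powr - \<beta> / 2"
      proof -
        have "\<rho> powr (\<beta> - y) \<le> ((1 / 2) powr (1 / (\<beta> - y))) powr (\<beta> - y)"
          using elim(3) y\<beta> by (intro powr_mono2) auto
        also have "\<dots> = 1 / 2" using y\<beta> by (simp add: powr_powr)
        finally have "\<rho> powr - \<beta> * \<rho> powr (\<beta> - y) \<le> \<rho> powr - \<beta> * (1 / 2)"
          by (rule mult_left_mono) simp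
        then show ?thesis by (simp add: powr_add[symmetric])
      qed
      ultimately have "ennreal (\<rho> powr - y) \<le> return_mean \<rho> p x"
        by (meson ennreal_leI order_trans)
      then show "ereal y \<le> return_exponent p x \<rho>" by (rule log_rate_ge[OF \<rho>])
    qed
  qed
  then show ?thesis using that[of "1 - \<delta>" p] \<delta> by simp
qed

text \<open>The estimate at one radius turns a small local exponent, at frequently or eventually all
  radii, into a small return exponent, for every delay \<open>p\<close>.\<close>

lemma recurrence_rates_le_local_dims:
  assumes x: "regular_point x" and dim: "0 < lower_local_dim \<mu> x"
  shows "lower_recurrence_rate P \<theta> T x \<le> lower_local_dim \<mu> x"
    and "upper_recurrence_rate P \<theta> T x \<le> upper_local_dim \<mu> x"
proof -
  have nontriv: "at_right (0 :: real) \<noteq> bot" by simp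
  have le_dims: "lower_local_dim \<mu> x \<le> upper_local_dim \<mu> x"
    unfolding lower_local_dim_def upper_local_dim_def by (rule Liminf_le_Limsup[OF nontriv])
  have split: "\<exists>c y'. d < ereal c \<and> 0 < c \<and> c < y' \<and> ereal y' = y" if dy: "0 < d" "d < y" "y \<noteq> \<infinity>" for d y :: ereal
  proof -
    obtain c where c: "d < ereal c" "ereal c < y" using ereal_dense2[OF dy(2)] by auto
    obtain y' where y': "y = ereal y'" using dy c(2) by (cases y) auto
    have "0 < ereal c" using dy(1) c(1) by (rule less_trans)
    then have "0 < c" by simp
    then show ?thesis using c y' by auto
  qed
  show "lower_recurrence_rate P \<theta> T x \<le> lower_local_dim \<mu> x"
  proof (rule dense_ge)
    fix y assume y: "lower_local_dim \<mu> x < y"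
    show "lower_recurrence_rate P \<theta> T x \<le> y"
    proof (cases "y = \<infinity>")
      case False
      obtain c y' where c: "lower_local_dim \<mu> x < ereal c" "0 < c" "c < y'" "ereal y' = y"
        using split[OF dim y False] by blast
      obtain s where s: "0 < s" and est: "\<And>p. \<forall>\<^sub>F \<rho> in at_right 0.
          local_exponent x (\<rho> powr s) < ereal c \<longrightarrow> return_exponent p x \<rho> \<le> ereal y'"
        using return_exponent_upper[OF x c(2,3)] by blast
      have "Liminf (at_right 0) (return_exponent p x) \<le> y" for p
      proof (rule ccontr)
        assume "\<not> ?thesis"
        then have "\<forall>\<^sub>F \<rho> in at_right 0. y < return_exponent p x \<rho>"
          by (intro less_LiminfD) simp
        with est[of p] have "\<forall>\<^sub>F \<rho> in at_right 0. ereal c \<le> local_exponent x (\<rho> powr s)"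
          by eventually_elim (use c(4) in auto)
        then have "\<forall>\<^sub>F r in at_right 0. ereal c \<le> local_exponent x r"
          using eventually_at_right_powr_iff[OF s, of "\<lambda>r. ereal c \<le> local_exponent x r"] by simp
        then have "ereal c \<le> lower_local_dim \<mu> x"
          unfolding lower_local_dim_def by (rule Liminf_bounded)
        with c(1) show False by simp
      qed
      then show ?thesis unfolding lower_recurrence_rate_eq_SUP by (intro SUP_least)
    qed simp
  qed
  show "upper_recurrence_rate P \<theta> T x \<le> upper_local_dim \<mu> x"
  proof (rule dense_ge)
    fix y assume y: "upper_local_dim \<mu> x < y"
    show "upper_recurrence_rate P \<theta> T x \<le> y"
    proof (cases "y = \<infinity>")
      case False
      obtain c y' where c: "upper_local_dim \<mu> x < ereal c" "0 < c" "c < y'" "ereal y' = y"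
        using split[OF less_le_trans[OF dim le_dims] y False] by blast
      obtain s where s: "0 < s" and est: "\<And>p. \<forall>\<^sub>F \<rho> in at_right 0.
          local_exponent x (\<rho> powr s) < ereal c \<longrightarrow> return_exponent p x \<rho> \<le> ereal y'"
        using return_exponent_upper[OF x c(2,3)] by blast
      have "\<forall>\<^sub>F r in at_right 0. local_exponent x r < ereal c"
        using c(1) unfolding upper_local_dim_def by (rule Limsup_lessD)
      then have small: "\<forall>\<^sub>F \<rho> in at_right 0. local_exponent x (\<rho> powr s) < ereal c"
        using eventually_at_right_powr_iff[OF s, of "\<lambda>r. local_exponent x r < ereal c"] by simp
      have "Limsup (at_right 0) (return_exponent p x) \<le> y" for p
      proof (rule Limsup_bounded)
        show "\<forall>\<^sub>F \<rho> in at_right 0. return_exponent p x \<rho> \<le> y"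
          using est[of p] small by eventually_elim (use c(4) in auto)
      qed
      then show ?thesis unfolding upper_recurrence_rate_eq_SUP by (intro SUP_least)
    qed simp
  qed
qed

text \<open>The delay \<open>p\<close> here depends on the exponent that is approached, and the supremum over \<open>p\<close>
  lets one rate reach the dimension.\<close>

lemma local_dims_le_recurrence_rates:
  assumes x: "regular_point x" and dim: "0 < lower_local_dim \<mu> x"
  shows "lower_local_dim \<mu> x \<le> lower_recurrence_rate P \<theta> T x"
    and "upper_local_dim \<mu> x \<le> upper_recurrence_rate P \<theta> T x"
proof -
  have nontriv: "at_right (0 :: real) \<noteq> bot" by simp
  have le_dims: "lower_local_dim \<mu> x \<le> upper_local_dim \<mu> x"
    unfolding lower_local_dim_def upper_local_dim_def by (rule Liminf_le_Limsup[OF nontriv])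
  have split: "\<exists>c y'. ereal c < d \<and> 0 < c \<and> y' < c \<and> ereal y' = y" if dy: "0 < d" "y < d" "y \<noteq> - \<infinity>" for d y :: ereal
  proof -
    have "max y 0 < d" using dy by simp
    then obtain c where c: "max y 0 < ereal c" "ereal c < d" using ereal_dense2 by blast
    obtain y' where "y = ereal y'" using dy c(1) by (cases y) auto
    then show ?thesis using c by auto
  qed
  show "lower_local_dim \<mu> x \<le> lower_recurrence_rate P \<theta> T x"
  proof (rule dense_le)
    fix y assume y: "y < lower_local_dim \<mu> x"
    show "y \<le> lower_recurrence_rate P \<theta> T x"
    proof (cases "y = - \<infinity>")
      case False
      obtain c y' where c: "ereal c < lower_local_dim \<mu> x" "0 < c" "y' < c" "ereal y' = y"
        using split[OF dim y False] by blast
      obtain s p where s: "0 < s" and est: "\<forall>\<^sub>F \<rho> in at_right 0.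
          ereal c < local_exponent x (\<rho> powr s) \<longrightarrow> ereal y' \<le> return_exponent p x \<rho>"
        using return_exponent_lower[OF x dim c(2,3)] by blast
      have "\<forall>\<^sub>F r in at_right 0. ereal c < local_exponent x r"
        using c(1) unfolding lower_local_dim_def by (rule less_LiminfD)
      then have large: "\<forall>\<^sub>F \<rho> in at_right 0. ereal c < local_exponent x (\<rho> powr s)"
        using eventually_at_right_powr_iff[OF s, of "\<lambda>r. ereal c < local_exponent x r"] by simp
      have "y \<le> Liminf (at_right 0) (return_exponent p x)"
      proof (rule Liminf_bounded)
        show "\<forall>\<^sub>F \<rho> in at_right 0. y \<le> return_exponent p x \<rho>"
          using est large by eventually_elim (use c(4) in auto)
      qed
      then show ?thesis unfolding lower_recurrence_rate_eq_SUP by (intro SUP_upper2[of p]) auto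
    qed simp
  qed
  show "upper_local_dim \<mu> x \<le> upper_recurrence_rate P \<theta> T x"
  proof (rule dense_le)
    fix y assume y: "y < upper_local_dim \<mu> x"
    show "y \<le> upper_recurrence_rate P \<theta> T x"
    proof (cases "y = - \<infinity>")
      case False
      obtain c y' where c: "ereal c < upper_local_dim \<mu> x" "0 < c" "y' < c" "ereal y' = y"
        using split[OF less_le_trans[OF dim le_dims] y False] by blast
      obtain s p where s: "0 < s" and est: "\<forall>\<^sub>F \<rho> in at_right 0.
          ereal c < local_exponent x (\<rho> powr s) \<longrightarrow> ereal y' \<le> return_exponent p x \<rho>"
        using return_exponent_lower[OF x dim c(2,3)] by blast
      have "y \<le> Limsup (at_right 0) (return_exponent p x)"
      proof (rule ccontr)
        assume "\<not> ?thesis"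
        then have "\<forall>\<^sub>F \<rho> in at_right 0. return_exponent p x \<rho> < y"
          by (intro Limsup_lessD) simp
        with est have "\<forall>\<^sub>F \<rho> in at_right 0. local_exponent x (\<rho> powr s) \<le> ereal c"
          by eventually_elim (use c(4) in auto)
        then have "\<forall>\<^sub>F r in at_right 0. local_exponent x r \<le> ereal c"
          using eventually_at_right_powr_iff[OF s, of "\<lambda>r. local_exponent x r \<le> ereal c"] by simp
        then have "upper_local_dim \<mu> x \<le> ereal c"
          unfolding upper_local_dim_def by (rule Limsup_bounded)
        with c(1) show False by simp
      qed
      then show ?thesis unfolding upper_recurrence_rate_eq_SUP by (intro SUP_upper2[of p]) auto
    qed simp
  qed
qed

end

theorem theorem18:
  fixes \<A> :: "('x::{metric_space, second_countable_topology}, 'e::euclidean_space) chart set"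
    and g :: "('x, 'e) chart \<Rightarrow> 'e \<Rightarrow> 'e \<Rightarrow> 'e \<Rightarrow> real"
    and P :: "'w::metric_space measure"
    and \<theta> :: "'w \<Rightarrow> 'w"
    and T :: "'w \<Rightarrow> 'x \<Rightarrow> 'x"
    and \<mu> :: "'x measure"
  assumes "riemannian_manifold \<A> g"
    and "compact (UNIV :: 'x set)"
    and "random_dynamical_system P \<theta> T"
    and "stationary_measure P \<theta> T \<mu>"
    and "superpolynomial_decay P \<theta> T \<mu>"
  shows "AE x in \<mu>. lower_local_dim \<mu> x > 0 \<longrightarrow>
           lower_recurrence_rate P \<theta> T x = lower_local_dim \<mu> x \<and>
           upper_recurrence_rate P \<theta> T x = upper_local_dim \<mu> x"
proof -
  interpret stationary_rds P \<theta> T \<mu>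
    using assms(3,4) by (simp add: stationary_rds_def stationary_rds_axioms_def)
  obtain K where pack: "polynomial_packing K DIM('e) (UNIV :: 'x set)"
    using riemannian_manifold.compact_polynomial_packing[OF assms(1,2)] by blast
  obtain \<rho> where fast: "\<And>q. 0 < q \<Longrightarrow> (\<lambda>n. \<rho> n * real n powr q) \<longlonglongrightarrow> 0"
    and corr: "correlation_bound \<rho>"
    using assms(5) unfolding superpolynomial_decay_def correlation_bound_def by blast
  have "AE x in \<mu>. regular_point x"
    using pack corr fast by (rule AE_regular_point)
  then show ?thesis
  proof eventually_elim
    case (elim x)
    then show ?case
      using recurrence_rates_le_local_dims local_dims_le_recurrence_rates by (auto intro: antisym)
  qed
qed

end
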